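(* Let $N\ge2$, $\omega\in\mathbb{R}$, and consider a network of $N$ phase oscillators $\theta_k\in\mathbb{S}^1$ with dynamics $$\dot\theta_k=\omega+\sum_{\substack{j=1\\ j\ne k}}^{N}\Gamma(\theta_k-\theta_j),\qquad k=1,\dots,N,$$ where the coupling function $\Gamma:\mathbb{R}\to\mathbb{R}$ is $2\pi$-periodic, twice differentiable on $(0,2\pi)$ with finite one-sided limits $\Gamma(0^+)$ and $\Gamma(2\pi^-)$, and strictly monotone in the sense that either $\Gamma'(\theta)>0$ for all $\theta\in(0,2\pi)$ or $\Gamma'(\theta)<0$ for all $\theta\in(0,2\pi)$. Suppose that the curvature of $\Gamma$ has constant sign on $(0,2\pi)$, i.e. either $\Gamma''(\theta)\ge0$ for all $\theta\in(0,2\pi)$ or $\Gamma''(\theta)\le0$ for all $\theta\in(0,2\pi)$. Let $\tilde\theta_k=\theta_{k+1}-\theta_1\in[0,2\pi]$, $k=1,\dots,N-1$, denote the phase differences, with the oscillators labelled so that $\tilde\theta_k\le\tilde\theta_{k+1}$. Then, for almost every initial condition: - if $\Gamma$ is strictly decreasing on $(0,2\pi)$ ($\Gamma'<0$), the oscillators asymptotically converge to the splay state configuration $\tilde\theta_k^*=k\frac{2\pi}{N}$, $k\in\{1,\dots,N-1\}$; - if $\Gamma$ is strictly increasing on $(0,2\pi)$ ($\Gamma'>0$), the oscillators achieve perfect synchronization $\theta_1(t)=\theta_2(t)=\dots=\theta_N(t)$ on $\mathbb{S}^1$ (i.e. $\tilde\theta_k\in\{0,2\pi\}$ for all $k$)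 in finite time.
   Context: The phase differences satisfy $$\dot{\tilde\theta}_k=\Gamma(\tilde\theta_k)+\sum_{\substack{j=1\\ j\ne k}}^{N-1}\Gamma(\tilde\theta_k-\tilde\theta_j)-\sum_{j=1}^{N-1}\Gamma(-\tilde\theta_j),\qquad k=1,\dots,N-1,$$ and evolve in the closure $\bar{\mathcal{C}}$ of the open cone $\mathcal{C}=\{\tilde\Theta\in(0,2\pi)^{N-1}:\tilde\theta_k<\tilde\theta_{k+1},\ k=1,\dots,N-2\}$; the phase ordering does not change over time since the oscillators are identical. The function $\Gamma$ is discontinuous at multiples of $2\pi$, with $\Gamma(0)=\Gamma(2\pi)$ by periodicity. An orbit that reaches the boundary of $\mathcal{C}$ corresponds to the synchronization of at least two oscillators. Convention: synchronized oscillators remain synchronized forever; that is, with $\tilde\theta_0:=0$ and $\tilde\theta_N:=2\pi$, each set $\{\tilde\Theta\in\bar{\mathcal{C}}:\tilde\theta_{i-1}=\tilde\theta_i\}$, $i=1,\dots,N$, and each intersection of such sets is invariant, and after reaching it the orbit evolves according to the phase-difference equations $\dot{\tilde\theta}_k=\Gamma(\tilde\theta_k)+\sum_{j=1,\,j\ne k}^{N-1}\Gamma(\tilde\theta_k-\tilde\theta_j)-\sum_{j=1}^{N-1}\Gamma(-\tilde\theta_j)$, $k=1,\dots,N-1$, restricted to it, with the terms $\Gamma$ evaluated at phase difference $0$ or $\pm2\pi$ equal to $\Gamma(0)$. "Almost every" is with respect to Lebesgue measure on the space of initial conditions. *)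

theory Defs
  imports "HOL-Analysis.Analysis"
begin

definition coupling_function :: "(real \<Rightarrow> real) \<Rightarrow> bool" where
  "coupling_function \<Gamma> \<longleftrightarrow>
     (\<forall>x. \<Gamma> (x + 2 * pi) = \<Gamma> x) \<and>
     \<Gamma> differentiable_on {0<..<2 * pi} \<and>
     deriv \<Gamma> differentiable_on {0<..<2 * pi} \<and>
     (\<exists>l. (\<Gamma> \<longlongrightarrow> l) (at_right 0)) \<and>
     (\<exists>l. (\<Gamma> \<longlongrightarrow> l) (at_left (2 * pi)))"

text \<open>
  Oscillators are numbered from \<open>1\<close> to \<open>N\<close>, and \<open>\<theta> k t\<close> is a real lift of the phase of
  oscillator \<open>k\<close> at time \<open>t\<close>. The phase difference number \<open>0\<close> is \<open>\<theta> 1 t - \<theta> 1 t = 0\<close>, and the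
  one with number \<open>N\<close> is \<open>2 * pi\<close> by convention.
\<close>

definition phase_diff :: "nat \<Rightarrow> (nat \<Rightarrow> real \<Rightarrow> real) \<Rightarrow> nat \<Rightarrow> real \<Rightarrow> real" where
  "phase_diff N \<theta> k t = (if k = N then 2 * pi else \<theta> (Suc k) t - \<theta> 1 t)"

definition closed_cone :: "nat \<Rightarrow> (nat \<Rightarrow> real) set" where
  "closed_cone N =
     {x. (\<forall>k\<in>{1..N - 1}. 0 \<le> x k \<and> x k \<le> 2 * pi) \<and>
         (\<forall>k. 1 \<le> k \<and> k + 1 \<le> N - 1 \<longrightarrow> x k \<le> x (k + 1))}"

text \<open>
  The velocities jump when oscillators meet, so the equations are imposed on the right derivative
  of a continuous motion; since \<open>\<Gamma>\<close> is continuous off the multiples of \<open>2 * pi\<close>, this gives the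
  usual derivative at all other positive times. After a meeting, the equations are those restricted
  to the synchronized set: by periodicity, the terms of synchronized pairs all equal \<open>\<Gamma> 0\<close>.

  The last clause is the convention that synchronized oscillators remain synchronized. Together with
  continuity it also preserves the phase ordering, so a motion whose initial phase differences
  lie in the closed cone never leaves it.
\<close>

definition network_solution ::
    "nat \<Rightarrow> real \<Rightarrow> (real \<Rightarrow> real) \<Rightarrow> (nat \<Rightarrow> real \<Rightarrow> real) \<Rightarrow> bool" where
  "network_solution N \<omega> \<Gamma> \<theta> \<longleftrightarrow>
     (\<forall>k\<in>{1..N}. continuous_on {0..} (\<theta> k)) \<and>
     (\<forall>k\<in>{1..N}. \<forall>t\<ge>0.
        (\<theta> k has_real_derivative \<omega> + (\<Sum>j\<in>{1..N} - {k}. \<Gamma> (\<theta> k t - \<theta> j t)))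
          (at t within {t..})) \<and>
     (\<forall>i\<in>{1..N}. \<forall>s t. 0 \<le> s \<and> s \<le> t \<and> phase_diff N \<theta> (i - 1) s = phase_diff N \<theta> i s
        \<longrightarrow> phase_diff N \<theta> (i - 1) t = phase_diff N \<theta> i t)"

end

theory Submission
  imports Defs
begin

text \<open>
  Two motions \<open>\<theta>\<close> and \<open>\<psi>\<close> of the network are compared through \<open>u k = \<theta> k - \<psi> k\<close>. Suppose that at each
  moment the phase differences \<open>\<theta> k - \<theta> j\<close> and \<open>\<psi> k - \<psi> j\<close> either coincide or lie in a common interval
  between consecutive multiples of \<open>2 * pi\<close>. If \<open>\<Gamma>\<close> increases there, each term of the derivative of
  \<open>u k\<close> has the sign of \<open>u k - u j\<close>. Hence the largest \<open>u k\<close> moves up, the smallest moves down, and the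
  spread \<open>max u - min u\<close>, which is a distance modulo a common rotation, cannot shrink; as long as it is
  at least \<open>\<delta> > 0\<close> it grows at a rate bounded below. If \<open>\<Gamma>\<close> decreases, all signs are reversed. The
  arbitrary value \<open>\<Gamma> 0\<close> cancels in the comparison, because synchronized pairs contribute it to both
  motions (lemmas \<open>spread_expands\<close> and \<open>spread_contracts\<close>).

  Decreasing coupling. The motion \<open>\<theta>\<close> is compared with itself under the cyclic relabelling
  \<open>k \<mapsto> k + 1\<close>, for which \<open>u\<close> lists the \<open>N\<close> gaps between neighbouring oscillators. The smallest gap
  cannot decrease, so a motion that starts in the open cone never meets its boundary; and the spread
  of the gaps tends to \<open>0\<close>. As the gaps add up to \<open>2 * pi\<close>, each tends to \<open>2 * pi / N\<close>. Only the
  boundary of the cone, a null set, is excluded.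

  Increasing coupling. A motion is labelled by its set of collapsed gaps, which can only grow and
  therefore becomes constant. In the end all oscillators are synchronized unless the motion is stuck
  forever in the interior of a face of the cone with at least two clusters. Two motions that stay
  forever in the same open face must coincide up to rotation, since otherwise their spread would
  grow without bound; so every face holds at most one stuck point. The stuck initial conditions are
  obtained by going backwards from these points through larger and larger faces. Within a face,
  distances do not increase backwards in time, and the speed is bounded, so each passage to a larger
  face adds just one Lipschitz parameter, the time spent in that face, whereas the dimension of the
  face also rises by at least one. A face of dimension \<open>d\<close> thus contains a set of stuck points of
  box dimension at most \<open>d - 1\<close> (lemma \<open>stuck_covered\<close>), and in the open cone, of dimension \<open>N - 1\<close>,
  this is a null set (lemma \<open>AE_not_in_covered\<close>).
\<close>

section \<open>Maxima of finite families with right derivatives\<close>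

text \<open>
  The mean value inequality for a lower right Dini derivative. The velocities jump when oscillators
  meet, and a maximum of several functions has corners, so two-sided derivatives are not available.
  The set of times up to which the bound holds with slope \<open>c - e\<close> is closed, and from its supremum it
  extends to the right.
\<close>

lemma dini_growth:
  fixes M :: "real \<Rightarrow> real"
  assumes "a \<le> b" and cont: "continuous_on {a..b} M"
    and step: "\<And>t e. t \<in> {a..<b} \<Longrightarrow> e > 0 \<Longrightarrow> \<forall>\<^sub>F s in at_right t. (c - e) * (s - t) \<le> M s - M t"
  shows "c * (b - a) \<le> M b - M a"
proof -
  have weak: "(c - e) * (b - a) \<le> M b - M a" if "e > 0" for e
  proof -
    define S where "S = {t \<in> {a..b}. (c - e) * (t - a) \<le> M t - M a}"
    have "closed S"
      unfolding S_def by (intro closed_Collect_le continuous_on_closed_Collect_le continuous_intros cont)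
    moreover have "a \<in> S" using \<open>a \<le> b\<close> by (simp add: S_def)
    moreover have bdd: "bdd_above S" by (rule bdd_aboveI[of _ b]) (simp add: S_def)
    ultimately have top: "Sup S \<in> S" by (intro closed_contains_Sup) auto
    have "Sup S = b"
    proof (rule ccontr)
      assume "Sup S \<noteq> b"
      with top have lt: "Sup S \<in> {a..<b}" by (auto simp: S_def)
      have "\<forall>\<^sub>F s in at_right (Sup S). (c - e) * (s - Sup S) \<le> M s - M (Sup S)"
        by (rule step[OF lt \<open>e > 0\<close>])
      moreover have "\<forall>\<^sub>F s in at_right (Sup S). s \<in> {Sup S<..<b}"
        using lt by (intro eventually_at_right_real) auto
      ultimately have "\<forall>\<^sub>F s in at_right (Sup S). s \<in> S \<and> Sup S < s"
      proof eventually_elim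
        case (elim s)
        with top have "(c - e) * (s - Sup S) + (c - e) * (Sup S - a) \<le> M s - M a"
          by (auto simp: S_def)
        moreover have "(c - e) * (s - Sup S) + (c - e) * (Sup S - a) = (c - e) * (s - a)"
          by (simp add: algebra_simps)
        ultimately show ?case using elim lt by (auto simp: S_def)
      qed
      then obtain s where "s \<in> S" "Sup S < s"
        using eventually_happens trivial_limit_at_right_real by blast
      with cSup_upper[OF _ bdd] show False by fastforce
    qed
    with top show ?thesis by (simp add: S_def)
  qed
  show ?thesis
  proof (rule field_le_epsilon)
    fix r :: real assume "r > 0"
    have *: "r / (b - a + 1) * (b - a) \<le> r"
      using \<open>r > 0\<close> \<open>a \<le> b\<close> by (simp add: field_simps)
    have "(c - r / (b - a + 1)) * (b - a) \<le> M b - M a"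
      using \<open>r > 0\<close> \<open>a \<le> b\<close> by (intro weak) simp
    with * show "c * (b - a) \<le> M b - M a + r" by (simp add: left_diff_distrib)
  qed
qed

lemma right_derivative_approx:
  assumes "(f has_real_derivative D) (at t within {t..})" "e > 0"
  shows "\<forall>\<^sub>F s in at_right t. \<bar>f s - f t - D * (s - t)\<bar> \<le> e * (s - t)"
proof -
  have "(f has_real_derivative D) (at t within {t<..})"
    using assms(1) by (rule DERIV_subset) auto
  then have "((\<lambda>s. (f s - f t) / (s - t)) \<longlongrightarrow> D) (at_right t)"
    by (simp add: has_field_derivative_iff)
  then have "\<forall>\<^sub>F s in at_right t. dist ((f s - f t) / (s - t)) D < e"
    using \<open>e > 0\<close> by (rule tendstoD)
  moreover have "\<forall>\<^sub>F s in at_right t. t < s" by (simp add: eventually_at_right_less)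
  ultimately show ?thesis
  proof eventually_elim
    case (elim s)
    have "f s - f t - D * (s - t) = ((f s - f t) / (s - t) - D) * (s - t)"
      using elim by (simp add: field_simps)
    then have "\<bar>f s - f t - D * (s - t)\<bar> = \<bar>(f s - f t) / (s - t) - D\<bar> * (s - t)"
      using elim by (simp add: abs_mult)
    also have "\<dots> \<le> e * (s - t)" using elim by (intro mult_right_mono) (auto simp: dist_real_def)
    finally show ?case .
  qed
qed

lemma continuous_on_finite_Max:
  fixes f :: "'p \<Rightarrow> 'a::topological_space \<Rightarrow> real"
  assumes "finite P" "P \<noteq> {}" "\<And>p. p \<in> P \<Longrightarrow> continuous_on S (f p)"
  shows "continuous_on S (\<lambda>t. Max ((\<lambda>p. f p t) ` P))"
  using assms
proof (induction P rule: finite_ne_induct)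
  case (insert x F)
  then have "continuous_on S (\<lambda>t. max (f x t) (Max ((\<lambda>p. f p t) ` F)))"
    by (intro continuous_on_max) auto
  with insert.hyps show ?case by simp
qed simp

text \<open>
  From below, the maximum is supported by any member that attains it. From above, as in
  \<open>finite_max_decays\<close>, the other members matter as well; they stay below the maximum for a short time
  by continuity.
\<close>

lemma finite_max_grows:
  fixes f D :: "'p \<Rightarrow> real \<Rightarrow> real"
  assumes "a \<le> b" and P: "finite P" "P \<noteq> {}"
    and cont: "\<And>p. p \<in> P \<Longrightarrow> continuous_on {a..b} (f p)"
    and deriv: "\<And>p t. p \<in> P \<Longrightarrow> t \<in> {a..<b} \<Longrightarrow> (f p has_real_derivative D p t) (at t within {t..})"
    and active: "\<And>p t. p \<in> P \<Longrightarrow> t \<in> {a..<b} \<Longrightarrow> f p t = Max ((\<lambda>p. f p t) ` P) \<Longrightarrow> c \<le> D p t"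
  shows "c * (b - a) \<le> Max ((\<lambda>p. f p b) ` P) - Max ((\<lambda>p. f p a) ` P)"
proof (rule dini_growth)
  fix t e :: real assume t: "t \<in> {a..<b}" and "e > 0"
  have "Max ((\<lambda>p. f p t) ` P) \<in> (\<lambda>p. f p t) ` P" using P by (intro Max_in) auto
  then obtain p where p: "p \<in> P" "f p t = Max ((\<lambda>p. f p t) ` P)" by auto
  have "\<forall>\<^sub>F s in at_right t. t < s" by (simp add: eventually_at_right_less)
  with right_derivative_approx[OF deriv[OF p(1) t] \<open>e > 0\<close>]
  show "\<forall>\<^sub>F s in at_right t. (c - e) * (s - t) \<le> Max ((\<lambda>p. f p s) ` P) - Max ((\<lambda>p. f p t) ` P)"
  proof eventually_elim
    case (elim s)
    have "(c - e) * (s - t) \<le> (D p t - e) * (s - t)"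
      using active[OF p(1) t p(2)] elim by (intro mult_right_mono) auto
    also have "\<dots> \<le> f p s - f p t" using elim by (simp add: algebra_simps abs_le_iff)
    also have "\<dots> \<le> Max ((\<lambda>p. f p s) ` P) - Max ((\<lambda>p. f p t) ` P)"
      using P p by (auto intro!: Max_ge)
    finally show ?case .
  qed
qed (use assms in \<open>auto intro: continuous_on_finite_Max\<close>)

lemma finite_max_decays:
  fixes f D :: "'p \<Rightarrow> real \<Rightarrow> real"
  assumes "a \<le> b" and P: "finite P" "P \<noteq> {}"
    and cont: "\<And>p. p \<in> P \<Longrightarrow> continuous_on {a..b} (f p)"
    and deriv: "\<And>p t. p \<in> P \<Longrightarrow> t \<in> {a..<b} \<Longrightarrow> (f p has_real_derivative D p t) (at t within {t..})"
    and active: "\<And>p t. p \<in> P \<Longrightarrow> t \<in> {a..<b} \<Longrightarrow> f p t = Max ((\<lambda>p. f p t) ` P) \<Longrightarrow> c \<le> - D p t"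
  shows "c * (b - a) \<le> Max ((\<lambda>p. f p a) ` P) - Max ((\<lambda>p. f p b) ` P)"
proof -
  define M where "M t = Max ((\<lambda>p. f p t) ` P)" for t
  have "c * (b - a) \<le> - M b - - M a"
  proof (rule dini_growth[where M = "\<lambda>t. - M t"])
    fix t e :: real assume t: "t \<in> {a..<b}" and "e > 0"
    have "\<forall>\<^sub>F s in at_right t. f p s \<le> M t - (c - e) * (s - t)" if "p \<in> P" for p
    proof (cases "f p t = M t")
      case True
      have "\<forall>\<^sub>F s in at_right t. t < s" by (simp add: eventually_at_right_less)
      with right_derivative_approx[OF deriv[OF that t] \<open>e > 0\<close>] show ?thesis
      proof eventually_elim
        case (elim s)
        have "(c - e) * (s - t) \<le> (- D p t - e) * (s - t)"
          using active[OF that t] True elim by (intro mult_right_mono) (auto simp: M_def)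
        with elim True show ?case by (simp add: algebra_simps abs_le_iff)
      qed
    next
      case False
      have "f p t \<le> M t" using P that by (auto simp: M_def)
      with False have lt: "f p t < M t - (c - e) * (t - t)" by simp
      have "continuous (at t within {t..}) (f p)"
        using deriv[OF that t] by (rule DERIV_continuous)
      then have "(f p \<longlongrightarrow> f p t) (at_right t)"
        unfolding continuous_within by (rule tendsto_within_subset) auto
      moreover have "((\<lambda>s. M t - (c - e) * (s - t)) \<longlongrightarrow> M t - (c - e) * (t - t)) (at_right t)"
        by (intro tendsto_intros)
      ultimately have "((\<lambda>s. M t - (c - e) * (s - t) - f p s) \<longlongrightarrow> M t - (c - e) * (t - t) - f p t) (at_right t)"
        by (rule tendsto_diff[rotated])
      then have "\<forall>\<^sub>F s in at_right t. 0 < M t - (c - e) * (s - t) - f p s"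
        using lt by (intro order_tendstoD(1)) auto
      then show ?thesis by eventually_elim simp
    qed
    then have "\<forall>\<^sub>F s in at_right t. \<forall>p\<in>P. f p s \<le> M t - (c - e) * (s - t)"
      using P(1) by (simp add: eventually_ball_finite)
    then show "\<forall>\<^sub>F s in at_right t. (c - e) * (s - t) \<le> - M s - - M t"
    proof eventually_elim
      case (elim s)
      then have "M s \<le> M t - (c - e) * (s - t)" using P by (auto simp: M_def[of s])
      then show ?case by simp
    qed
  next
    show "continuous_on {a..b} (\<lambda>t. - M t)"
      unfolding M_def using P cont by (intro continuous_on_minus continuous_on_finite_Max)
  qed (fact \<open>a \<le> b\<close>)
  then show ?thesis by (simp add: M_def)
qed

section \<open>Comparing two motions\<close>

definition spread :: "'i set \<Rightarrow> ('i \<Rightarrow> real) \<Rightarrow> real" where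
  "spread I u = Max ((\<lambda>(j, k). u j - u k) ` (I \<times> I))"

lemma spread_ge:
  assumes "finite I" "j \<in> I" "k \<in> I"
  shows "u j - u k \<le> spread I u"
  unfolding spread_def using assms by (intro Max_ge) auto

lemma spread_leI:
  assumes "finite I" "I \<noteq> {}" "\<And>j k. j \<in> I \<Longrightarrow> k \<in> I \<Longrightarrow> u j - u k \<le> c"
  shows "spread I u \<le> c"
  unfolding spread_def using assms by (subst Max_le_iff) auto

lemma spread_nonneg:
  assumes "finite I" "I \<noteq> {}"
  shows "0 \<le> spread I u"
  using assms spread_ge[OF assms(1), of _ _ u] by force

lemma spread_add:
  assumes "finite I" "I \<noteq> {}"
  shows "spread I (\<lambda>k. u k + v k) \<le> spread I u + spread I v"
proof (rule spread_leI[OF assms])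
  fix j k assume "j \<in> I" "k \<in> I"
  with spread_ge[OF assms(1) this, of u] spread_ge[OF assms(1) this, of v]
  show "u j + v j - (u k + v k) \<le> spread I u + spread I v" by simp
qed

lemma spread_minus:
  assumes "finite I" "I \<noteq> {}"
  shows "spread I (\<lambda>k. v k - u k) = spread I (\<lambda>k. u k - v k)"
proof (rule antisym)
  have "spread I (\<lambda>k. f k - g k) \<le> spread I (\<lambda>k. g k - f k)" for f g :: "'a \<Rightarrow> real"
  proof (rule spread_leI[OF assms])
    fix j k assume "j \<in> I" "k \<in> I"
    from spread_ge[OF assms(1) this(2,1), of "\<lambda>k. g k - f k"]
    show "f j - g j - (f k - g k) \<le> spread I (\<lambda>k. g k - f k)" by simp
  qed
  then show "spread I (\<lambda>k. v k - u k) \<le> spread I (\<lambda>k. u k - v k)"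
    "spread I (\<lambda>k. u k - v k) \<le> spread I (\<lambda>k. v k - u k)" by blast+
qed

text \<open>
  Phase differences of oscillators lie in \<open>[- 2 * pi, 2 * pi]\<close>. The case \<open>a = b\<close> covers the values
  \<open>0\<close> and \<open>\<plusminus> 2 * pi\<close> taken by synchronized pairs, where \<open>\<Gamma>\<close> may jump.
\<close>

definition same_branch :: "real \<Rightarrow> real \<Rightarrow> bool" where
  "same_branch a b \<longleftrightarrow> a = b \<or> {a, b} \<subseteq> {0<..<2 * pi} \<or> {a, b} \<subseteq> {- (2 * pi)<..<0}"

definition increasing_coupling :: "(real \<Rightarrow> real) \<Rightarrow> bool" where
  "increasing_coupling G \<longleftrightarrow> (\<forall>x. G (x + 2 * pi) = G x) \<and> strict_mono_on {0<..<2 * pi} G"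

text \<open>
  The pair \<open>(0, 0)\<close> expresses monotonicity and a pair \<open>(\<delta>, \<mu>)\<close> with \<open>\<mu> > 0\<close> strict monotonicity with a
  uniform modulus, so the comparison theorems below yield both the sign and the rate.
\<close>

definition coupling_gain :: "(real \<Rightarrow> real) \<Rightarrow> real \<Rightarrow> real \<Rightarrow> bool" where
  "coupling_gain G \<delta> \<mu> \<longleftrightarrow> 0 \<le> \<delta> \<and> (\<forall>a b. same_branch a b \<and> \<delta> \<le> a - b \<longrightarrow> \<mu> \<le> G a - G b)"

text \<open>
  Periodicity carries an estimate on \<open>(0, 2 * pi)\<close> over to the branch \<open>(- 2 * pi, 0)\<close>.
\<close>

lemma coupling_gain_lift:
  assumes G: "increasing_coupling G" and "0 \<le> \<delta>" "\<delta> = 0 \<Longrightarrow> \<mu> \<le> 0"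
    and step: "\<And>a b. {a, b} \<subseteq> {0<..<2 * pi} \<Longrightarrow> \<delta> \<le> a - b \<Longrightarrow> \<mu> \<le> G a - G b"
  shows "coupling_gain G \<delta> \<mu>"
  unfolding coupling_gain_def
proof (intro conjI allI impI)
  fix a b assume ab: "same_branch a b \<and> \<delta> \<le> a - b"
  consider "a = b" | "{a, b} \<subseteq> {0<..<2 * pi}" | "{a, b} \<subseteq> {- (2 * pi)<..<0}"
    using ab by (auto simp: same_branch_def)
  then show "\<mu> \<le> G a - G b"
  proof cases
    case 3
    then have "\<mu> \<le> G (a + 2 * pi) - G (b + 2 * pi)" using ab by (intro step) auto
    with G show ?thesis by (simp add: increasing_coupling_def)
  qed (use assms ab in auto)
qed (fact \<open>0 \<le> \<delta>\<close>)

lemma coupling_gain_zero: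
  assumes "increasing_coupling G"
  shows "coupling_gain G 0 0"
proof (rule coupling_gain_lift[OF assms])
  fix a b assume "{a, b} \<subseteq> {0<..<2 * pi}" "0 \<le> a - b"
  with assms show "0 \<le> G a - G b"
    by (cases "a = b") (auto simp: increasing_coupling_def dest!: strict_mono_onD[of _ _ b a])
qed auto

text \<open>
  A strictly increasing function gains a uniform amount over all intervals of length \<open>\<delta>\<close>: each of
  them contains two consecutive points of the grid of mesh \<open>\<delta> / 3\<close>, and only finitely many grid points
  lie in \<open>(0, 2 * pi)\<close>.
\<close>

lemma coupling_gain_positive:
  assumes G: "increasing_coupling G" and "\<delta> > 0"
  obtains \<mu> where "\<mu> > 0" "coupling_gain G \<delta> \<mu>"
proof -
  define h where "h = \<delta> / 3"
  have h: "h > 0" using \<open>\<delta> > 0\<close> by (simp add: h_def)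
  define I where "I = {i::nat. 1 \<le> i \<and> (real i + 1) * h < 2 * pi}"
  have "I \<subseteq> {..nat \<lceil>2 * pi / h\<rceil>}"
  proof
    fix i assume "i \<in> I"
    then have "(real i + 1) * h < 2 * pi" by (simp add: I_def)
    then have "real i + 1 < 2 * pi / h" using h by (simp add: field_simps)
    then show "i \<in> {..nat \<lceil>2 * pi / h\<rceil>}" by simp linarith
  qed
  then have fin: "finite I" by (rule finite_subset) simp
  define \<mu> where "\<mu> = Min (insert 1 ((\<lambda>i. G ((real i + 1) * h) - G (real i * h)) ` I))"
  have mono: "G x < G y" if "0 < x" "x < y" "y < 2 * pi" for x y
    using G that by (intro strict_mono_onD[of "{0<..<2 * pi}" G]) (auto simp: increasing_coupling_def)
  have "\<mu> > 0"
  proof -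
    have "G (real i * h) < G ((real i + 1) * h)" if "i \<in> I" for i
      using that h by (intro mono) (auto simp: I_def)
    then show ?thesis unfolding \<mu>_def using fin by (subst Min_gr_iff) auto
  qed
  moreover have "coupling_gain G \<delta> \<mu>"
  proof (rule coupling_gain_lift[OF G])
    fix a b assume ab: "{a, b} \<subseteq> {0<..<2 * pi}" "\<delta> \<le> a - b"
    define i where "i = nat (\<lfloor>b / h\<rfloor> + 1)"
    have "0 \<le> b / h" using ab h by simp
    then have ri: "real i = real_of_int \<lfloor>b / h\<rfloor> + 1" "i \<ge> 1" by (auto simp: i_def le_nat_iff)
    have "b / h < real i" "real i \<le> b / h + 1" using ri by linarith+
    then have i: "b < real i * h" "real i * h \<le> b + h" using h by (auto simp: field_simps)
    then have i': "(real i + 1) * h < a" using ab h \<open>\<delta> > 0\<close> by (auto simp: algebra_simps h_def)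
    then have "i \<in> I" using ri ab by (simp add: I_def)
    then have "\<mu> \<le> G ((real i + 1) * h) - G (real i * h)"
      unfolding \<mu>_def using fin by (intro Min_le) auto
    also have "\<dots> \<le> G a - G b"
      using mono[of "(real i + 1) * h" a] mono[of b "real i * h"] i i' ab h
      by (auto simp: algebra_simps)
    finally show "\<mu> \<le> G a - G b" .
  qed (use \<open>\<delta> > 0\<close> in auto)
  ultimately show ?thesis by (rule that)
qed

text \<open>
  The derivative of \<open>v k - w k\<close> when \<open>v\<close> and \<open>w\<close> move by the network equations with coupling \<open>G\<close>.
\<close>

definition drift_gap :: "'i set \<Rightarrow> (real \<Rightarrow> real) \<Rightarrow> ('i \<Rightarrow> real) \<Rightarrow> ('i \<Rightarrow> real) \<Rightarrow> 'i \<Rightarrow> real" where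
  "drift_gap I G v w k = (\<Sum>j\<in>I - {k}. G (v k - v j) - G (w k - w j))"

lemma drift_gap_commute: "drift_gap I G w v k = - drift_gap I G v w k"
  by (simp add: drift_gap_def sum_negf[symmetric])

lemma same_branch_commute: "same_branch a b \<longleftrightarrow> same_branch b a"
  by (auto simp: same_branch_def)

text \<open>
  Where \<open>v k - w k\<close> is largest, \<open>v k - v j\<close> is at least \<open>w k - w j\<close> for every \<open>j\<close>, so no term of the sum is
  negative.
\<close>

lemma drift_gap_at_max:
  assumes G: "increasing_coupling G" and fin: "finite I"
    and branch: "\<And>j. j \<in> I \<Longrightarrow> same_branch (v k - v j) (w k - w j)"
    and max: "\<And>j. j \<in> I \<Longrightarrow> v j - w j \<le> v k - w k"
  shows "0 \<le> drift_gap I G v w k"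
    and "\<lbrakk>coupling_gain G \<delta> \<mu>; i \<in> I - {k}; \<delta> \<le> (v k - w k) - (v i - w i)\<rbrakk> \<Longrightarrow> \<mu> \<le> drift_gap I G v w k"
proof -
  have nonneg: "0 \<le> G (v k - v j) - G (w k - w j)" if "j \<in> I" for j
    using coupling_gain_zero[OF G] branch[OF that] max[OF that] unfolding coupling_gain_def by simp
  then show "0 \<le> drift_gap I G v w k"
    unfolding drift_gap_def by (intro sum_nonneg) auto
  assume gain: "coupling_gain G \<delta> \<mu>" and i: "i \<in> I - {k}" and d: "\<delta> \<le> (v k - w k) - (v i - w i)"
  have "\<mu> \<le> G (v k - v i) - G (w k - w i)"
    using gain branch[of i] i d by (simp add: coupling_gain_def)
  also have "\<dots> \<le> drift_gap I G v w k"
    unfolding drift_gap_def using fin nonneg i by (intro member_le_sum) auto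
  finally show "\<mu> \<le> drift_gap I G v w k" .
qed

text \<open>
  At a pair that realizes the spread, the upper member does not move down, the lower one does not
  move up, and their mutual interaction alone contributes the gain \<open>\<mu>\<close>.
\<close>

lemma drift_gap_at_extremes:
  assumes G: "increasing_coupling G" and fin: "finite I" and pq: "p \<in> I" "q \<in> I"
    and branch: "\<And>j k. j \<in> I \<Longrightarrow> k \<in> I \<Longrightarrow> same_branch (v k - v j) (w k - w j)"
    and extreme: "(v p - w p) - (v q - w q) = spread I (\<lambda>k. v k - w k)"
    and gain: "coupling_gain G \<delta> \<mu>" "\<delta> \<le> spread I (\<lambda>k. v k - w k)"
  shows "\<mu> \<le> drift_gap I G v w p - drift_gap I G v w q"
proof (cases "p = q")
  case True
  with extreme gain have "\<delta> = 0" by (simp add: coupling_gain_def)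
  (* Equal phases gain nothing. *)
  then have "\<mu> \<le> 0" using gain(1) by (auto simp: coupling_gain_def same_branch_def dest: spec[of _ 0])
  with True show ?thesis by simp
next
  case False
  have "\<mu> \<le> drift_gap I G v w p"
  proof (rule drift_gap_at_max(2)[OF G fin _ _ gain(1), where i = q])
    fix j assume "j \<in> I"
    from spread_ge[OF fin this pq(2), of "\<lambda>k. v k - w k"] extreme
    show "v j - w j \<le> v p - w p" by simp
  qed (use False pq branch gain extreme in auto)
  moreover have "0 \<le> drift_gap I G w v q"
  proof (rule drift_gap_at_max(1)[OF G fin])
    fix j assume "j \<in> I"
    from spread_ge[OF fin pq(1) this, of "\<lambda>k. v k - w k"] extreme
    show "w j - v j \<le> w q - v q" by simp
  qed (use pq branch same_branch_commute in auto)
  ultimately show ?thesis by (simp add: drift_gap_commute[of I G w v])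
qed

definition flow_on :: "nat \<Rightarrow> real \<Rightarrow> (real \<Rightarrow> real) \<Rightarrow> real \<Rightarrow> (nat \<Rightarrow> real \<Rightarrow> real) \<Rightarrow> bool" where
  "flow_on N \<omega> \<Gamma> b \<theta> \<longleftrightarrow> 0 \<le> b \<and> (\<forall>k\<in>{1..N}. continuous_on {0..b} (\<theta> k)) \<and>
     (\<forall>k\<in>{1..N}. \<forall>t\<in>{0..<b}.
        (\<theta> k has_real_derivative \<omega> + (\<Sum>j\<in>{1..N} - {k}. \<Gamma> (\<theta> k t - \<theta> j t))) (at t within {t..}))"

definition branches_agree :: "nat \<Rightarrow> real \<Rightarrow> (nat \<Rightarrow> real \<Rightarrow> real) \<Rightarrow> (nat \<Rightarrow> real \<Rightarrow> real) \<Rightarrow> bool" where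
  "branches_agree N b \<theta> \<psi> \<longleftrightarrow> (\<forall>t\<in>{0..<b}. \<forall>j\<in>{1..N}. \<forall>k\<in>{1..N}.
     same_branch (\<theta> k t - \<theta> j t) (\<psi> k t - \<psi> j t))"

lemma flow_on_difference:
  assumes "flow_on N \<omega> \<Gamma> b \<theta>" "flow_on N \<omega> \<Gamma> b \<psi>" "k \<in> {1..N}" "t \<in> {0..<b}"
  shows "((\<lambda>s. \<theta> k s - \<psi> k s) has_real_derivative drift_gap {1..N} \<Gamma> (\<lambda>k. \<theta> k t) (\<lambda>k. \<psi> k t) k)
    (at t within {t..})"
proof -
  have "((\<lambda>s. \<theta> k s - \<psi> k s) has_real_derivative
      (\<omega> + (\<Sum>j\<in>{1..N} - {k}. \<Gamma> (\<theta> k t - \<theta> j t))) - (\<omega> + (\<Sum>j\<in>{1..N} - {k}. \<Gamma> (\<psi> k t - \<psi> j t))))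
    (at t within {t..})"
    using assms by (intro DERIV_diff) (auto simp: flow_on_def)
  then show ?thesis by (simp add: drift_gap_def sum_subtractf)
qed

lemma drift_gap_uminus: "drift_gap I (\<lambda>x. - G x) v w k = - drift_gap I G v w k"
  by (simp add: drift_gap_def sum_negf[symmetric])

context
  fixes N \<omega> \<Gamma> b \<theta> \<psi>
  assumes N: "1 \<le> N" and flows: "flow_on N \<omega> \<Gamma> b \<theta>" "flow_on N \<omega> \<Gamma> b \<psi>" and branches: "branches_agree N b \<theta> \<psi>"
begin

lemma spread_expands:
  assumes inc: "increasing_coupling \<Gamma>" and gain: "coupling_gain \<Gamma> \<delta> \<mu>"
    and large: "\<And>t. t \<in> {0..<b} \<Longrightarrow> \<delta> \<le> spread {1..N} (\<lambda>k. \<theta> k t - \<psi> k t)"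
  shows "spread {1..N} (\<lambda>k. \<theta> k 0 - \<psi> k 0) + \<mu> * b \<le> spread {1..N} (\<lambda>k. \<theta> k b - \<psi> k b)"
proof -
  define f where "f = (\<lambda>(p, q) t. (\<theta> p t - \<psi> p t) - (\<theta> q t - \<psi> q t))"
  define g where "g k t = drift_gap {1..N} \<Gamma> (\<lambda>k. \<theta> k t) (\<lambda>k. \<psi> k t) k" for k t
  have spread: "spread {1..N} (\<lambda>k. \<theta> k t - \<psi> k t) = Max ((\<lambda>p. f p t) ` ({1..N} \<times> {1..N}))" for t
    by (simp add: spread_def f_def case_prod_unfold)
  have "\<mu> * (b - 0) \<le> Max ((\<lambda>p. f p b) ` ({1..N} \<times> {1..N})) - Max ((\<lambda>p. f p 0) ` ({1..N} \<times> {1..N}))"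
  proof (rule finite_max_grows[where D = "\<lambda>(p, q) t. g p t - g q t"])
    show "continuous_on {0..b} (f p)" if "p \<in> {1..N} \<times> {1..N}" for p
      using that flows by (auto simp: f_def flow_on_def intro!: continuous_intros)
    show "(f p has_real_derivative (case p of (p, q) \<Rightarrow> \<lambda>t. g p t - g q t) t) (at t within {t..})"
      if "p \<in> {1..N} \<times> {1..N}" "t \<in> {0..<b}" for p t
      using that unfolding f_def g_def
      by (auto simp del: One_nat_def intro!: DERIV_diff[OF flow_on_difference flow_on_difference] flows)
    show "\<mu> \<le> (case p of (p, q) \<Rightarrow> \<lambda>t. g p t - g q t) t"
      if p: "p \<in> {1..N} \<times> {1..N}" and t: "t \<in> {0..<b}"
        and max: "f p t = Max ((\<lambda>p. f p t) ` ({1..N} \<times> {1..N}))" for p t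
    proof (cases p)
      case (Pair i j)
      have "\<mu> \<le> g i t - g j t"
        unfolding g_def
      proof (rule drift_gap_at_extremes[OF inc _ _ _ _ _ gain])
        show "\<theta> i t - \<psi> i t - (\<theta> j t - \<psi> j t) = spread {1..N} (\<lambda>k. \<theta> k t - \<psi> k t)"
          using max unfolding spread by (simp add: Pair f_def)
      qed (use p Pair branches t large in \<open>auto simp: branches_agree_def\<close>)
      then show ?thesis by (simp add: Pair)
    qed
  qed (use N flows in \<open>auto simp: flow_on_def\<close>)
  then show ?thesis unfolding spread by simp
qed

lemma spread_contracts:
  assumes dec: "increasing_coupling (\<lambda>x. - \<Gamma> x)" and gain: "coupling_gain (\<lambda>x. - \<Gamma> x) \<delta> \<mu>"
    and large: "\<And>t. t \<in> {0..<b} \<Longrightarrow> \<delta> \<le> spread {1..N} (\<lambda>k. \<theta> k t - \<psi> k t)"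
  shows "spread {1..N} (\<lambda>k. \<theta> k b - \<psi> k b) \<le> spread {1..N} (\<lambda>k. \<theta> k 0 - \<psi> k 0) - \<mu> * b"
proof -
  define f where "f = (\<lambda>(p, q) t. (\<theta> p t - \<psi> p t) - (\<theta> q t - \<psi> q t))"
  define g where "g k t = drift_gap {1..N} \<Gamma> (\<lambda>k. \<theta> k t) (\<lambda>k. \<psi> k t) k" for k t
  have spread: "spread {1..N} (\<lambda>k. \<theta> k t - \<psi> k t) = Max ((\<lambda>p. f p t) ` ({1..N} \<times> {1..N}))" for t
    by (simp add: spread_def f_def case_prod_unfold)
  have "\<mu> * (b - 0) \<le> Max ((\<lambda>p. f p 0) ` ({1..N} \<times> {1..N})) - Max ((\<lambda>p. f p b) ` ({1..N} \<times> {1..N}))"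
  proof (rule finite_max_decays[where D = "\<lambda>(p, q) t. g p t - g q t"])
    show "continuous_on {0..b} (f p)" if "p \<in> {1..N} \<times> {1..N}" for p
      using that flows by (auto simp: f_def flow_on_def intro!: continuous_intros)
    show "(f p has_real_derivative (case p of (p, q) \<Rightarrow> \<lambda>t. g p t - g q t) t) (at t within {t..})"
      if "p \<in> {1..N} \<times> {1..N}" "t \<in> {0..<b}" for p t
      using that unfolding f_def g_def
      by (auto simp del: One_nat_def intro!: DERIV_diff[OF flow_on_difference flow_on_difference] flows)
    show "\<mu> \<le> - (case p of (p, q) \<Rightarrow> \<lambda>t. g p t - g q t) t"
      if p: "p \<in> {1..N} \<times> {1..N}" and t: "t \<in> {0..<b}"
        and max: "f p t = Max ((\<lambda>p. f p t) ` ({1..N} \<times> {1..N}))" for p t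
    proof (cases p)
      case (Pair i j)
      have "\<mu> \<le> drift_gap {1..N} (\<lambda>x. - \<Gamma> x) (\<lambda>k. \<theta> k t) (\<lambda>k. \<psi> k t) i
          - drift_gap {1..N} (\<lambda>x. - \<Gamma> x) (\<lambda>k. \<theta> k t) (\<lambda>k. \<psi> k t) j"
      proof (rule drift_gap_at_extremes[OF dec _ _ _ _ _ gain])
        show "\<theta> i t - \<psi> i t - (\<theta> j t - \<psi> j t) = spread {1..N} (\<lambda>k. \<theta> k t - \<psi> k t)"
          using max unfolding spread by (simp add: Pair f_def)
      qed (use p Pair branches t large in \<open>auto simp: branches_agree_def\<close>)
      then show ?thesis by (simp add: Pair g_def drift_gap_uminus)
    qed
  qed (use N flows in \<open>auto simp: flow_on_def\<close>)
  then show ?thesis unfolding spread by simp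
qed

text \<open>
  The one-sided part of the contraction, needed to keep every gap positive: the spread of the gaps
  alone would not prevent a gap from closing.
\<close>

lemma least_difference_grows:
  assumes dec: "increasing_coupling (\<lambda>x. - \<Gamma> x)" and k: "k \<in> {1..N}"
    and init: "\<And>j. j \<in> {1..N} \<Longrightarrow> m \<le> \<theta> j 0 - \<psi> j 0"
  shows "m \<le> \<theta> k b - \<psi> k b"
proof -
  define f where "f k t = - (\<theta> k t - \<psi> k t)" for k t
  define g where "g k t = drift_gap {1..N} \<Gamma> (\<lambda>k. \<theta> k t) (\<lambda>k. \<psi> k t) k" for k t
  have "0 * (b - 0) \<le> Max ((\<lambda>k. f k 0) ` {1..N}) - Max ((\<lambda>k. f k b) ` {1..N})"
  proof (rule finite_max_decays[where D = "\<lambda>k t. - g k t"])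
    show "continuous_on {0..b} (f k)" if "k \<in> {1..N}" for k
      using that flows unfolding f_def by (auto simp: flow_on_def intro!: continuous_intros)
    show "(f k has_real_derivative - g k t) (at t within {t..})"
      if "k \<in> {1..N}" "t \<in> {0..<b}" for k t
      unfolding f_def g_def using that by (intro DERIV_minus flow_on_difference[OF flows])
    show "0 \<le> - (- g k t)"
      if k: "k \<in> {1..N}" and t: "t \<in> {0..<b}" and max: "f k t = Max ((\<lambda>k. f k t) ` {1..N})" for k t
    proof -
      have "0 \<le> drift_gap {1..N} (\<lambda>x. - \<Gamma> x) (\<lambda>k. \<psi> k t) (\<lambda>k. \<theta> k t) k"
      proof (rule drift_gap_at_max(1)[OF dec])
        fix j assume j: "j \<in> {1..N}"
        then have "f j t \<le> Max ((\<lambda>k. f k t) ` {1..N})" by (intro Max_ge) auto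
        then have "f j t \<le> f k t" by (simp add: max)
        then show "\<psi> j t - \<theta> j t \<le> \<psi> k t - \<theta> k t" by (simp add: f_def)
        show "same_branch (\<psi> k t - \<psi> j t) (\<theta> k t - \<theta> j t)"
          using branches j k t by (subst same_branch_commute) (simp add: branches_agree_def)
      qed simp
      then show ?thesis
        by (simp add: g_def drift_gap_uminus drift_gap_commute[of _ _ "\<lambda>k. \<psi> k t"])
    qed
  qed (use N flows in \<open>auto simp: flow_on_def\<close>)
  moreover have "f k b \<le> Max ((\<lambda>k. f k b) ` {1..N})" using k by (intro Max_ge) auto
  moreover have "f j 0 \<le> - m" if "j \<in> {1..N}" for j
    using init[OF that] by (simp add: f_def)
  then have "Max ((\<lambda>k. f k 0) ` {1..N}) \<le> - m"
    using N by (subst Max_le_iff) auto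
  ultimately show ?thesis by (simp add: f_def)
qed

end

section \<open>Collapsed gaps and the cone of phase differences\<close>

definition cone_at :: "nat \<Rightarrow> (nat \<Rightarrow> real \<Rightarrow> real) \<Rightarrow> real \<Rightarrow> bool" where
  "cone_at N \<theta> t \<longleftrightarrow> (\<forall>i\<in>{1..N}. phase_diff N \<theta> (i - 1) t \<le> phase_diff N \<theta> i t)"

definition collapsed :: "nat \<Rightarrow> (nat \<Rightarrow> real \<Rightarrow> real) \<Rightarrow> real \<Rightarrow> nat set" where
  "collapsed N \<theta> t = {i \<in> {1..N}. phase_diff N \<theta> (i - 1) t = phase_diff N \<theta> i t}"

lemma phase_diff_ends:
  assumes "1 \<le> N"
  shows "phase_diff N \<theta> 0 t = 0" "phase_diff N \<theta> N t = 2 * pi"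
  using assms by (auto simp: phase_diff_def)

lemma phase_difference:
  assumes "j \<in> {1..N}" "k \<in> {1..N}"
  shows "\<theta> k t - \<theta> j t = phase_diff N \<theta> (k - 1) t - phase_diff N \<theta> (j - 1) t"
  using assms by (auto simp: phase_diff_def)

lemma phase_diff_mono:
  assumes "cone_at N \<theta> t" "a \<le> b" "b \<le> N"
  shows "phase_diff N \<theta> a t \<le> phase_diff N \<theta> b t"
  using assms(2,3)
proof (induction b rule: dec_induct)
  case (step n)
  then have "phase_diff N \<theta> (Suc n - 1) t \<le> phase_diff N \<theta> (Suc n) t"
    using assms(1) unfolding cone_at_def by (intro bspec[where x = "Suc n"]) auto
  with step show ?case by simp
qed simp

text \<open>
  Which pairs of oscillators coincide is read off from the collapsed gaps.
\<close>

lemma phase_diff_eq_iff: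
  assumes cone: "cone_at N \<theta> t" and "a \<le> b" "b \<le> N"
  shows "phase_diff N \<theta> a t = phase_diff N \<theta> b t \<longleftrightarrow> {a<..b} \<subseteq> collapsed N \<theta> t"
proof
  assume eq: "phase_diff N \<theta> a t = phase_diff N \<theta> b t"
  show "{a<..b} \<subseteq> collapsed N \<theta> t"
  proof
    fix i assume i: "i \<in> {a<..b}"
    then have "a \<le> i - 1" "i - 1 \<le> i" "i \<le> b" "i - 1 \<le> N" "i \<le> N" using \<open>b \<le> N\<close> by auto
    with phase_diff_mono[OF cone, of a "i - 1"] phase_diff_mono[OF cone, of "i - 1" i]
      phase_diff_mono[OF cone, of i b] eq \<open>b \<le> N\<close>
    have "phase_diff N \<theta> (i - 1) t = phase_diff N \<theta> i t" by linarith
    with i \<open>b \<le> N\<close>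
    show "i \<in> collapsed N \<theta> t" by (auto simp: collapsed_def)
  qed
next
  show "phase_diff N \<theta> a t = phase_diff N \<theta> b t" if "{a<..b} \<subseteq> collapsed N \<theta> t"
    using assms(2) that
  proof (induction b rule: dec_induct)
    case (step n)
    then have "{a<..n} \<subseteq> collapsed N \<theta> t" "Suc n \<in> collapsed N \<theta> t" by auto
    with step show ?case by (simp add: collapsed_def)
  qed simp
qed

text \<open>
  Two states in the same open face have their phase differences on the same branches: a difference is
  \<open>0\<close> if all gaps between the two oscillators are collapsed, \<open>\<plusminus> 2 * pi\<close> if all remaining gaps are, and
  strictly in between otherwise.
\<close>

lemma same_branch_of_collapsed_eq:
  assumes N: "1 \<le> N" and cone: "cone_at N \<theta> t" "cone_at N \<psi> s"
    and eq: "collapsed N \<theta> t = collapsed N \<psi> s" and jk: "j \<in> {1..N}" "k \<in> {1..N}"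
  shows "same_branch (\<theta> k t - \<theta> j t) (\<psi> k s - \<psi> j s)"
proof -
  have *: "phase_diff N \<theta> b t - phase_diff N \<theta> a t = phase_diff N \<psi> b s - phase_diff N \<psi> a s \<or>
      {phase_diff N \<theta> b t - phase_diff N \<theta> a t, phase_diff N \<psi> b s - phase_diff N \<psi> a s} \<subseteq> {0<..<2 * pi}"
    if ab: "a \<le> b" "b \<le> N" for a b
  proof -
    note ends = phase_diff_ends[OF N]
    have iff: "phase_diff N \<theta> a t = phase_diff N \<theta> b t \<longleftrightarrow> phase_diff N \<psi> a s = phase_diff N \<psi> b s"
      if "a \<le> b" "b \<le> N" for a b
      using phase_diff_eq_iff[OF cone(1) that] phase_diff_eq_iff[OF cone(2) that] eq by simp
    have range: "0 \<le> phase_diff N \<theta> a t" "phase_diff N \<theta> a t \<le> phase_diff N \<theta> b t" "phase_diff N \<theta> b t \<le> 2 * pi"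
      "0 \<le> phase_diff N \<psi> a s" "phase_diff N \<psi> a s \<le> phase_diff N \<psi> b s" "phase_diff N \<psi> b s \<le> 2 * pi"
      using phase_diff_mono[OF cone(1), of 0 a] phase_diff_mono[OF cone(1), of a b] phase_diff_mono[OF cone(1), of b N]
        phase_diff_mono[OF cone(2), of 0 a] phase_diff_mono[OF cone(2), of a b] phase_diff_mono[OF cone(2), of b N]
        ab by (auto simp: ends)
    have inside: "y - x \<in> {0<..<2 * pi}"
      if "0 \<le> x" "x \<le> y" "y \<le> 2 * pi" "x \<noteq> y" "\<not> (0 = x \<and> y = 2 * pi)" for x y :: real
      using that by (cases "x = 0") auto
    show ?thesis
    proof (cases "phase_diff N \<theta> a t = phase_diff N \<theta> b t \<or>
        (phase_diff N \<theta> 0 t = phase_diff N \<theta> a t \<and> phase_diff N \<theta> b t = phase_diff N \<theta> N t)")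
      case True
      with iff[of a b] iff[of 0 a] iff[of b N] ab show ?thesis
        by (elim disjE conjE) (simp_all add: ends)
    next
      case False
      with iff[OF ab] iff[OF le0 order_trans[OF ab]] iff[OF ab(2) order_refl]
      have "\<not> (phase_diff N \<psi> a s = phase_diff N \<psi> b s \<or>
        (phase_diff N \<psi> 0 s = phase_diff N \<psi> a s \<and> phase_diff N \<psi> b s = phase_diff N \<psi> N s))" by blast
      with False inside[OF range(1-3)] inside[OF range(4-6)] show ?thesis
        unfolding ends by blast
    qed
  qed
  consider "j \<le> k" | "k \<le> j" by linarith
  then show ?thesis
  proof cases
    case 1
    then have "j - 1 \<le> k - 1" "k - 1 \<le> N" using jk by auto
    from *[OF this] show ?thesis
      unfolding same_branch_def phase_difference[OF jk] by auto
  next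
    case 2
    then have "k - 1 \<le> j - 1" "j - 1 \<le> N" using jk by auto
    from *[OF this] show ?thesis
      unfolding same_branch_def phase_difference[OF jk] by auto
  qed
qed

lemma network_solutionD:
  assumes "network_solution N \<omega> \<Gamma> \<theta>" "k \<in> {1..N}"
  shows "continuous_on {0..} (\<theta> k)"
    and "0 \<le> t \<Longrightarrow> (\<theta> k has_real_derivative \<omega> + (\<Sum>j\<in>{1..N} - {k}. \<Gamma> (\<theta> k t - \<theta> j t))) (at t within {t..})"
  using assms unfolding network_solution_def by (elim conjE; blast)+

lemma synchronized_forever:
  assumes "network_solution N \<omega> \<Gamma> \<theta>" "i \<in> {1..N}" "0 \<le> s" "s \<le> t"
    and "phase_diff N \<theta> (i - 1) s = phase_diff N \<theta> i s"
  shows "phase_diff N \<theta> (i - 1) t = phase_diff N \<theta> i t"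
proof -
  from assms(1) have "\<forall>i\<in>{1..N}. \<forall>s t. 0 \<le> s \<and> s \<le> t \<and> phase_diff N \<theta> (i - 1) s = phase_diff N \<theta> i s
      \<longrightarrow> phase_diff N \<theta> (i - 1) t = phase_diff N \<theta> i t"
    unfolding network_solution_def by (elim conjE)
  from bspec[OF this assms(2), THEN spec[of _ s], THEN spec[of _ t]] assms(3-) show ?thesis by simp
qed

lemma network_solution_shift:
  assumes sol: "network_solution N \<omega> \<Gamma> \<theta>" and "0 \<le> s"
  shows "network_solution N \<omega> \<Gamma> (\<lambda>k t. \<theta> k (s + t))"
  unfolding network_solution_def
proof (intro conjI ballI allI impI)
  fix k assume k: "k \<in> {1..N}"
  show "continuous_on {0..} (\<lambda>t. \<theta> k (s + t))"
    using \<open>0 \<le> s\<close>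
    by (intro continuous_on_compose2[OF network_solutionD(1)[OF sol k]] continuous_intros) auto
  fix t :: real assume "0 \<le> t"
  then have "(\<theta> k has_real_derivative \<omega> + (\<Sum>j\<in>{1..N} - {k}. \<Gamma> (\<theta> k (s + t) - \<theta> j (s + t))))
    (at (s + t) within {s + t..})"
    using \<open>0 \<le> s\<close> by (intro network_solutionD(2)[OF sol k]) auto
  then have "(\<theta> k has_real_derivative \<omega> + (\<Sum>j\<in>{1..N} - {k}. \<Gamma> (\<theta> k (s + t) - \<theta> j (s + t))))
    (at (s + t) within (+) s ` {t..})" by simp
  moreover have "((+) s has_real_derivative 1) (at t within {t..})"
    by (auto intro!: derivative_eq_intros)
  ultimately have "(\<theta> k \<circ> (+) s has_real_derivative
      (\<omega> + (\<Sum>j\<in>{1..N} - {k}. \<Gamma> (\<theta> k (s + t) - \<theta> j (s + t)))) * 1) (at t within {t..})"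
    by (rule DERIV_image_chain)
  then show "((\<lambda>t. \<theta> k (s + t)) has_real_derivative
      \<omega> + (\<Sum>j\<in>{1..N} - {k}. \<Gamma> (\<theta> k (s + t) - \<theta> j (s + t)))) (at t within {t..})"
    by (simp add: o_def)
next
  fix i r t assume i: "i \<in> {1..N}"
    and "0 \<le> r \<and> r \<le> t \<and> phase_diff N (\<lambda>k t. \<theta> k (s + t)) (i - 1) r = phase_diff N (\<lambda>k t. \<theta> k (s + t)) i r"
  then have "0 \<le> s + r" "s + r \<le> s + t" "phase_diff N \<theta> (i - 1) (s + r) = phase_diff N \<theta> i (s + r)"
    using \<open>0 \<le> s\<close> by (auto simp: phase_diff_def)
  then have "phase_diff N \<theta> (i - 1) (s + t) = phase_diff N \<theta> i (s + t)"
    by (rule synchronized_forever[OF sol i])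
  then show "phase_diff N (\<lambda>k t. \<theta> k (s + t)) (i - 1) t = phase_diff N (\<lambda>k t. \<theta> k (s + t)) i t"
    by (simp add: phase_diff_def)
qed

lemma shift_simps:
  "cone_at N (\<lambda>k t. \<theta> k (s + t)) r \<longleftrightarrow> cone_at N \<theta> (s + r)"
  "collapsed N (\<lambda>k t. \<theta> k (s + t)) r = collapsed N \<theta> (s + r)"
  by (auto simp: cone_at_def collapsed_def phase_diff_def)

lemma network_solution_flow_on:
  assumes "network_solution N \<omega> \<Gamma> \<theta>" "0 \<le> b"
  shows "flow_on N \<omega> \<Gamma> b \<theta>"
  unfolding flow_on_def
proof (intro conjI ballI)
  fix k assume k: "k \<in> {1..N}"
  show "continuous_on {0..b} (\<theta> k)"
    by (rule continuous_on_subset[OF network_solutionD(1)[OF assms(1) k]]) auto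
  fix t assume "t \<in> {0..<b}"
  then show "(\<theta> k has_real_derivative \<omega> + (\<Sum>j\<in>{1..N} - {k}. \<Gamma> (\<theta> k t - \<theta> j t))) (at t within {t..})"
    by (intro network_solutionD(2)[OF assms(1) k]) auto
qed (fact assms(2))

lemma collapsed_mono:
  assumes "network_solution N \<omega> \<Gamma> \<theta>" "0 \<le> s" "s \<le> t"
  shows "collapsed N \<theta> s \<subseteq> collapsed N \<theta> t"
  using synchronized_forever[OF assms(1) _ assms(2,3)] unfolding collapsed_def by auto

lemma phase_diff_continuous:
  assumes "network_solution N \<omega> \<Gamma> \<theta>" "i \<le> N" "1 \<le> N"
  shows "continuous_on {0..} (phase_diff N \<theta> i)"
proof (cases "i = N")
  case False
  then have "continuous_on {0..} (\<theta> (Suc i))" "continuous_on {0..} (\<theta> 1)"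
    using assms by (auto intro!: network_solutionD(1)[OF assms(1)])
  then show ?thesis unfolding phase_diff_def[abs_def] using False
    by (auto intro: continuous_intros)
qed (simp add: phase_diff_def[abs_def])

text \<open>
  A gap that became negative would have vanished before, and a vanished gap stays zero.
\<close>

lemma cone_at_forever:
  assumes sol: "network_solution N \<omega> \<Gamma> \<theta>" and "cone_at N \<theta> 0" "0 \<le> t"
  shows "cone_at N \<theta> t"
  unfolding cone_at_def
proof (rule ballI, rule ccontr)
  fix i assume i: "i \<in> {1..N}" and neg: "\<not> phase_diff N \<theta> (i - 1) t \<le> phase_diff N \<theta> i t"
  define g where "g r = phase_diff N \<theta> i r - phase_diff N \<theta> (i - 1) r" for r
  have "continuous_on {0..t} g"
    unfolding g_def using i
    by (intro continuous_intros continuous_on_subset[OF phase_diff_continuous[OF sol]]) auto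
  moreover have "0 \<le> g 0" "g t < 0"
    using bspec[OF assms(2)[unfolded cone_at_def] i] neg by (simp_all add: g_def)
  ultimately obtain s where s: "0 \<le> s" "s \<le> t" "g s = 0"
    using IVT2'[of g t 0 0] \<open>0 \<le> t\<close> by auto
  from s(3) have "phase_diff N \<theta> (i - 1) s = phase_diff N \<theta> i s" unfolding g_def by linarith
  from synchronized_forever[OF sol i s(1,2) this] neg show False by linarith
qed

text \<open>
  The first time exists because the times at which a given gap is zero form a closed set.
\<close>

lemma first_collision:
  assumes sol: "network_solution N \<omega> \<Gamma> \<theta>" and "0 \<le> t" "collapsed N \<theta> t \<noteq> collapsed N \<theta> 0"
  obtains \<tau> where "0 \<le> \<tau>" "\<tau> \<le> t" "collapsed N \<theta> 0 \<subset> collapsed N \<theta> \<tau>"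
    "\<And>r. r \<in> {0..<\<tau>} \<Longrightarrow> collapsed N \<theta> r = collapsed N \<theta> 0"
proof -
  define Z where "Z = collapsed N \<theta> 0"
  define E where "E = (\<Union>i\<in>{1..N} - Z. {r \<in> {0..t}. phase_diff N \<theta> (i - 1) r = phase_diff N \<theta> i r})"
  have "r \<in> E \<longleftrightarrow> r \<in> {0..t} \<and> \<not> collapsed N \<theta> r \<subseteq> Z" for r
    unfolding E_def collapsed_def by blast
  moreover have "Z \<subseteq> collapsed N \<theta> r" if "0 \<le> r" for r
    unfolding Z_def using collapsed_mono[OF sol order_refl that] .
  ultimately have E: "r \<in> E \<longleftrightarrow> r \<in> {0..t} \<and> collapsed N \<theta> r \<noteq> Z" for r by auto
  have "closed E"
    unfolding E_def
  proof (intro closed_UN ballI)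
    fix i assume i: "i \<in> {1..N} - Z"
    have "closed {r \<in> {0..t}. phase_diff N \<theta> (i - 1) r - phase_diff N \<theta> i r = 0}"
      using i by (intro continuous_closed_preimage_constant continuous_intros
          continuous_on_subset[OF phase_diff_continuous[OF sol]]) auto
    then show "closed {r \<in> {0..t}. phase_diff N \<theta> (i - 1) r = phase_diff N \<theta> i r}"
      by (simp only: right_minus_eq)
  qed simp
  moreover have "t \<in> E" using assms by (simp add: E Z_def)
  moreover have bdd: "bdd_below E" by (rule bdd_belowI[of _ 0]) (simp add: E)
  ultimately have Inf: "Inf E \<in> E" by (intro closed_contains_Inf) auto
  show ?thesis
  proof (rule that)
    show "0 \<le> Inf E" "Inf E \<le> t" "collapsed N \<theta> 0 \<subset> collapsed N \<theta> (Inf E)"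
      using Inf collapsed_mono[OF sol, of 0 "Inf E"] by (auto simp: E Z_def)
    show "collapsed N \<theta> r = collapsed N \<theta> 0" if "r \<in> {0..<Inf E}" for r
      using that Inf cInf_lower[OF _ bdd, of r] by (force simp: E Z_def)
  qed
qed

section \<open>Decreasing coupling: convergence to the splay state\<close>

text \<open>
  The same motion with the oscillators relabelled cyclically. The last oscillator is succeeded by the
  first one a full turn ahead, which keeps the lifts in increasing order.
\<close>

definition next_phase :: "nat \<Rightarrow> (nat \<Rightarrow> real \<Rightarrow> real) \<Rightarrow> nat \<Rightarrow> real \<Rightarrow> real" where
  "next_phase N \<theta> k t = (if k = N then \<theta> 1 t + 2 * pi else \<theta> (Suc k) t)"

lemma next_phase_offset:
  assumes "k \<in> {1..N}"
  shows "next_phase N \<theta> k t = \<theta> 1 t + phase_diff N \<theta> k t"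
  using assms by (auto simp: next_phase_def phase_diff_def)

lemma next_phase_gap:
  assumes "k \<in> {1..N}"
  shows "next_phase N \<theta> k t - \<theta> k t = phase_diff N \<theta> k t - phase_diff N \<theta> (k - 1) t"
  using assms by (auto simp: next_phase_def phase_diff_def)

lemma next_phase_flow_on:
  assumes flow: "flow_on N \<omega> \<Gamma> b \<theta>" and per: "\<And>x. \<Gamma> (x + 2 * pi) = \<Gamma> x"
  shows "flow_on N \<omega> \<Gamma> b (next_phase N \<theta>)"
proof -
  define \<sigma> where "\<sigma> k = (if k = N then 1 else Suc k)" for k
  define c where "c k = (if k = N then 2 * pi else 0)" for k
  have next_eq: "next_phase N \<theta> k = (\<lambda>t. \<theta> (\<sigma> k) t + c k)" for k
    by (auto simp: next_phase_def \<sigma>_def c_def)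
  have per': "\<Gamma> (x - 2 * pi) = \<Gamma> x" for x using per[of "x - 2 * pi"] by simp
  have \<Gamma>_eq: "\<Gamma> (next_phase N \<theta> k t - next_phase N \<theta> j t) = \<Gamma> (\<theta> (\<sigma> k) t - \<theta> (\<sigma> j) t)" for j k t
  proof -
    have "next_phase N \<theta> k t - next_phase N \<theta> j t = (\<theta> (\<sigma> k) t - \<theta> (\<sigma> j) t) + (c k - c j)"
      by (simp add: next_eq)
    moreover consider "c k - c j = 0" | "c k - c j = 2 * pi" | "c k - c j = - (2 * pi)"
      unfolding c_def by (cases "k = N"; cases "j = N") simp_all
    then have "\<Gamma> (x + (c k - c j)) = \<Gamma> x" for x
      using per[of x] per'[of x] by cases (simp_all only: add_0_right diff_conv_add_uminus)
    ultimately show ?thesis by simp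
  qed
  have \<sigma>: "\<sigma> k \<in> {1..N}" if "k \<in> {1..N}" for k using that by (auto simp: \<sigma>_def)
  have bij: "bij_betw \<sigma> ({1..N} - {k}) ({1..N} - {\<sigma> k})" if "k \<in> {1..N}" for k
  proof -
    have inj: "inj_on \<sigma> {1..N}"
    proof (rule inj_onI)
      fix x y assume "x \<in> {1..N}" "y \<in> {1..N}" "\<sigma> x = \<sigma> y"
      then show "x = y" unfolding \<sigma>_def by (cases "x = N"; cases "y = N") auto
    qed
    have "\<sigma> ` {1..N} = {1..N}"
      using \<sigma> by (intro endo_inj_surj inj image_subsetI) auto
    then have "\<sigma> ` ({1..N} - {k}) = {1..N} - {\<sigma> k}"
      using that inj_on_image_set_diff[OF inj, of "{1..N}" "{k}"] by simp
    moreover have "inj_on \<sigma> ({1..N} - {k})" using inj by (rule inj_on_subset) blast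
    ultimately show ?thesis unfolding bij_betw_def by blast
  qed
  have sum: "(\<Sum>j\<in>{1..N} - {k}. \<Gamma> (next_phase N \<theta> k t - next_phase N \<theta> j t))
      = (\<Sum>j\<in>{1..N} - {\<sigma> k}. \<Gamma> (\<theta> (\<sigma> k) t - \<theta> j t))" if "k \<in> {1..N}" for k t
    unfolding \<Gamma>_eq using sum.reindex_bij_betw[OF bij[OF that], of "\<lambda>j. \<Gamma> (\<theta> (\<sigma> k) t - \<theta> j t)"] .
  show ?thesis
    unfolding flow_on_def
  proof (intro conjI ballI)
    show "0 \<le> b" using flow by (simp add: flow_on_def)
    fix k assume k: "k \<in> {1..N}"
    show "continuous_on {0..b} (next_phase N \<theta> k)"
      unfolding next_eq using flow \<sigma>[OF k] by (intro continuous_intros) (auto simp: flow_on_def)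
    fix t assume t: "t \<in> {0..<b}"
    have "(\<theta> (\<sigma> k) has_real_derivative \<omega> + (\<Sum>j\<in>{1..N} - {\<sigma> k}. \<Gamma> (\<theta> (\<sigma> k) t - \<theta> j t))) (at t within {t..})"
      using flow \<sigma>[OF k] t by (simp add: flow_on_def)
    from DERIV_add[OF this DERIV_const[of "c k"]]
    show "(next_phase N \<theta> k has_real_derivative \<omega> +
        (\<Sum>j\<in>{1..N} - {k}. \<Gamma> (next_phase N \<theta> k t - next_phase N \<theta> j t))) (at t within {t..})"
      unfolding sum[OF k] unfolding next_eq by simp
  qed
qed

lemma next_phase_branches_agree:
  assumes N: "1 \<le> N" and "\<And>t. t \<in> {0..<b} \<Longrightarrow> cone_at N \<theta> t" "\<And>t. t \<in> {0..<b} \<Longrightarrow> collapsed N \<theta> t = {}"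
  shows "branches_agree N b (next_phase N \<theta>) \<theta>"
  unfolding branches_agree_def
proof (intro ballI)
  fix t j k assume t: "t \<in> {0..<b}" and jk: "j \<in> {1..N}" "k \<in> {1..N}"
  have strict: "phase_diff N \<theta> a t < phase_diff N \<theta> b t" if "a < b" "b \<le> N" for a b
    using phase_diff_mono[OF assms(2)[OF t], of a b] phase_diff_eq_iff[OF assms(2)[OF t], of a b]
      assms(3)[OF t] that by auto
  have inside: "phase_diff N \<theta> b t - phase_diff N \<theta> a t \<in> {0<..<2 * pi}" if "a < b" "b \<le> N" "0 < a \<or> b < N" for a b
    using strict[of a b] strict[of 0 a] strict[of b N] phase_diff_ends[OF N, of \<theta> t] that
    by (cases "a = 0"; cases "b = N") auto
  consider "j = k" | "j < k" | "k < j" by linarith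
  then show "same_branch (next_phase N \<theta> k t - next_phase N \<theta> j t) (\<theta> k t - \<theta> j t)"
  proof cases
    case 2
    then have "j - 1 < k - 1" "k - 1 < N" using jk by auto
    with 2 inside[of j k] inside[of "j - 1" "k - 1"] jk show ?thesis
      unfolding phase_difference[OF jk, of \<theta>] next_phase_offset[OF jk(1)] next_phase_offset[OF jk(2)]
      by (auto simp: same_branch_def)
  next
    case 3
    then have "k - 1 < j - 1" "j - 1 < N" using jk by auto
    with 3 inside[of k j] inside[of "k - 1" "j - 1"] jk show ?thesis
      unfolding phase_difference[OF jk, of \<theta>] next_phase_offset[OF jk(1)] next_phase_offset[OF jk(2)]
      by (auto simp: same_branch_def)
  qed (simp add: same_branch_def)
qed

context
  fixes N \<omega> \<Gamma> \<theta>
  assumes N: "1 \<le> N" and dec: "increasing_coupling (\<lambda>x. - \<Gamma> x)"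
    and sol: "network_solution N \<omega> \<Gamma> \<theta>" and cone: "cone_at N \<theta> 0" and open_cone: "collapsed N \<theta> 0 = {}"
begin

lemma decreasing_periodic: "\<Gamma> (x + 2 * pi) = \<Gamma> x"
  using dec by (simp add: increasing_coupling_def)

text \<open>
  The smallest gap is nondecreasing up to the first collision, hence still positive there.
\<close>

lemma decreasing_no_collision:
  assumes "0 \<le> t"
  shows "collapsed N \<theta> t = {}"
proof (rule ccontr)
  assume "collapsed N \<theta> t \<noteq> {}"
  then obtain \<tau> where \<tau>: "0 \<le> \<tau>" "{} \<subset> collapsed N \<theta> \<tau>" "\<And>r. r \<in> {0..<\<tau>} \<Longrightarrow> collapsed N \<theta> r = {}"
    using first_collision[OF sol \<open>0 \<le> t\<close>] by (metis open_cone)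
  define m where "m = Min ((\<lambda>k. phase_diff N \<theta> k 0 - phase_diff N \<theta> (k - 1) 0) ` {1..N})"
  have "m > 0"
    unfolding m_def using N cone open_cone
    by (subst Min_gr_iff) (auto simp: cone_at_def collapsed_def less_le)
  have flow: "flow_on N \<omega> \<Gamma> \<tau> \<theta>" by (rule network_solution_flow_on[OF sol \<tau>(1)])
  have "m \<le> phase_diff N \<theta> k \<tau> - phase_diff N \<theta> (k - 1) \<tau>" if k: "k \<in> {1..N}" for k
    unfolding next_phase_gap[OF k, symmetric]
  proof (rule least_difference_grows[OF N next_phase_flow_on[OF flow decreasing_periodic] flow _ dec k])
    show "branches_agree N \<tau> (next_phase N \<theta>) \<theta>"
      using \<tau>(3) by (intro next_phase_branches_agree N cone_at_forever[OF sol cone]) auto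
    show "m \<le> next_phase N \<theta> j 0 - \<theta> j 0" if "j \<in> {1..N}" for j
      unfolding next_phase_gap[OF that] m_def using that by (intro Min_le) auto
  qed
  with \<open>m > 0\<close> \<tau>(2) show False by (force simp: collapsed_def)
qed

lemma decreasing_gap_spread_contracts:
  assumes "0 \<le> a" "a \<le> b" and gain: "coupling_gain (\<lambda>x. - \<Gamma> x) \<delta> \<mu>"
    and large: "\<And>t. t \<in> {a..<b} \<Longrightarrow> \<delta> \<le> spread {1..N} (\<lambda>k. next_phase N \<theta> k t - \<theta> k t)"
  shows "spread {1..N} (\<lambda>k. next_phase N \<theta> k b - \<theta> k b)
    \<le> spread {1..N} (\<lambda>k. next_phase N \<theta> k a - \<theta> k a) - \<mu> * (b - a)"
proof -
  define \<phi> where "\<phi> = (\<lambda>k t. \<theta> k (a + t))"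
  have next_\<phi>: "next_phase N \<phi> k t = next_phase N \<theta> k (a + t)" for k t
    by (simp add: next_phase_def \<phi>_def)
  have flow: "flow_on N \<omega> \<Gamma> (b - a) \<phi>"
    unfolding \<phi>_def using assms by (intro network_solution_flow_on network_solution_shift sol) auto
  have "branches_agree N (b - a) (next_phase N \<phi>) \<phi>"
    using \<open>0 \<le> a\<close> unfolding \<phi>_def
    by (intro next_phase_branches_agree N) (auto simp: shift_simps decreasing_no_collision cone_at_forever[OF sol cone])
  from spread_contracts[OF N next_phase_flow_on[OF flow decreasing_periodic] flow this dec gain]
  have "spread {1..N} (\<lambda>k. next_phase N \<theta> k (a + (b - a)) - \<theta> k (a + (b - a)))
    \<le> spread {1..N} (\<lambda>k. next_phase N \<theta> k (a + 0) - \<theta> k (a + 0)) - \<mu> * (b - a)"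
    unfolding next_\<phi> unfolding \<phi>_def using large \<open>0 \<le> a\<close> by simp
  then show ?thesis by simp
qed

text \<open>
  The spread of the gaps is nonincreasing, and as long as it exceeds \<open>d\<close> it loses at least \<open>\<mu>\<close> per unit of
  time; so it eventually drops below every \<open>d > 0\<close>. Every gap is within the spread of the mean gap
  \<open>2 * pi / N\<close>.
\<close>

lemma decreasing_converges_to_splay:
  assumes k: "k \<in> {1..N}"
  shows "(phase_diff N \<theta> k \<longlongrightarrow> real k * (2 * pi / real N)) at_top"
proof (rule tendstoI)
  fix e :: real assume "e > 0"
  define u where "u t k = phase_diff N \<theta> k t - phase_diff N \<theta> (k - 1) t" for t k
  define S where "S t = spread {1..N} (u t)" for t
  have S_eq: "S t = spread {1..N} (\<lambda>k. next_phase N \<theta> k t - \<theta> k t)" for t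
    unfolding S_def spread_def u_def
    by (intro arg_cong[where f = Max] image_cong) (auto simp: next_phase_gap)
  have S_nonneg: "0 \<le> S t" for t unfolding S_def using N by (intro spread_nonneg) auto
  define d where "d = e / (2 * real N)"
  have "d > 0" using \<open>e > 0\<close> N by (simp add: d_def)
  then obtain \<mu> where \<mu>: "\<mu> > 0" "coupling_gain (\<lambda>x. - \<Gamma> x) d \<mu>" using coupling_gain_positive[OF dec] by blast
  have "\<exists>t0\<ge>0. S t0 < d"
  proof (rule ccontr)
    assume "\<not> (\<exists>t0\<ge>0. S t0 < d)"
    then have large: "d \<le> S t" if "0 \<le> t" for t using that by force
    (* By this time the spread would have fallen to -1. *)
    define b where "b = (S 0 + 1) / \<mu>"
    have "0 \<le> b" using \<mu>(1) S_nonneg[of 0] by (simp add: b_def)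
    with large have "S b \<le> S 0 - \<mu> * (b - 0)"
      unfolding S_eq by (intro decreasing_gap_spread_contracts[OF _ _ \<mu>(2)]) auto
    also have "\<dots> = - 1" using \<mu>(1) by (simp add: b_def)
    finally show False using S_nonneg[of b] by simp
  qed
  then obtain t0 where t0: "0 \<le> t0" "S t0 < d" by blast
  have "dist (phase_diff N \<theta> k t) (real k * (2 * pi / real N)) < e" if "t0 \<le> t" for t
  proof -
    have "S t \<le> S t0 - 0 * (t - t0)"
      unfolding S_eq using t0(1) that S_nonneg unfolding S_eq
      by (intro decreasing_gap_spread_contracts[OF _ _ coupling_gain_zero[OF dec]])
    with t0 have St: "S t < d" by simp
    have tele: "phase_diff N \<theta> m t = (\<Sum>i\<in>{1..m}. u t i)" for m
    proof (induction m)
      case 0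
      then show ?case using N by (simp add: phase_diff_ends)
    next
      case (Suc m)
      then show ?case by (simp add: u_def)
    qed
    have close: "\<bar>u t i - 2 * pi / N\<bar> \<le> S t" if i: "i \<in> {1..N}" for i
    proof -
      (* The gaps sum to 2 * pi, so N times the deviation from the mean is a sum of gap differences. *)
      have "(\<Sum>j\<in>{1..N}. u t i - u t j) = N * (u t i - 2 * pi / N)"
        using tele[of N] N by (simp add: sum_subtractf phase_diff_ends algebra_simps)
      moreover have "\<bar>\<Sum>j\<in>{1..N}. u t i - u t j\<bar> \<le> (\<Sum>j\<in>{1..N}. \<bar>u t i - u t j\<bar>)" by (rule sum_abs)
      moreover have "\<bar>u t i - u t j\<bar> \<le> S t" if "j \<in> {1..N}" for j
        using spread_ge[OF _ i that, of "u t"] spread_ge[OF _ that i, of "u t"] by (simp add: S_def)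
      then have "(\<Sum>j\<in>{1..N}. \<bar>u t i - u t j\<bar>) \<le> N * S t"
        using sum_bounded_above[of "{1..N}" "\<lambda>j. \<bar>u t i - u t j\<bar>" "S t"] by simp
      ultimately have "\<bar>N * (u t i - 2 * pi / N)\<bar> \<le> N * S t" by simp
      then have "N * \<bar>u t i - 2 * pi / N\<bar> \<le> N * S t" by (simp only: abs_mult abs_of_nat)
      then show ?thesis using N by (simp add: mult_le_cancel_left)
    qed
    have "phase_diff N \<theta> k t - real k * (2 * pi / real N) = (\<Sum>i\<in>{1..k}. u t i - 2 * pi / N)"
      by (simp add: tele sum_subtractf)
    then have "dist (phase_diff N \<theta> k t) (real k * (2 * pi / real N)) \<le> (\<Sum>i\<in>{1..k}. \<bar>u t i - 2 * pi / N\<bar>)"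
      by (simp add: dist_real_def)
    also have "\<dots> \<le> k * S t"
      using sum_bounded_above[of "{1..k}" "\<lambda>i. \<bar>u t i - 2 * pi / N\<bar>" "S t"] close k by simp
    also have "\<dots> \<le> N * S t" using k S_nonneg by (intro mult_right_mono) auto
    also have "\<dots> \<le> N * d" using St by (intro mult_left_mono) auto
    also have "\<dots> < e" using \<open>e > 0\<close> N by (simp add: d_def)
    finally show ?thesis .
  qed
  then show "\<forall>\<^sub>F t in at_top. dist (phase_diff N \<theta> k t) (real k * (2 * pi / real N)) < e"
    by (auto intro: eventually_at_top_linorderI)
qed

end

section \<open>Sets of small box dimension are null\<close>

text \<open>
  At scale \<open>1 / m\<close> the set is covered by a number of small sets of the order of \<open>m ^ r\<close>. This is a
  quantitative form of having box dimension at most \<open>r\<close>, for a distance \<open>d\<close> that need not be a metric.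
\<close>

definition covering_family :: "('a \<Rightarrow> 'a \<Rightarrow> real) \<Rightarrow> nat \<Rightarrow> 'a set \<Rightarrow> nat \<Rightarrow> (nat \<Rightarrow> 'a set set) \<Rightarrow> bool" where
  "covering_family d r S C \<A> \<longleftrightarrow> (\<forall>m\<ge>1. finite (\<A> m) \<and> card (\<A> m) \<le> C * m ^ r \<and> S \<subseteq> \<Union>(\<A> m) \<and>
     (\<forall>A\<in>\<A> m. \<forall>x\<in>A. \<forall>y\<in>A. d x y \<le> 1 / real m))"

definition covered :: "('a \<Rightarrow> 'a \<Rightarrow> real) \<Rightarrow> nat \<Rightarrow> 'a set \<Rightarrow> bool" where
  "covered d r S \<longleftrightarrow> (\<exists>C \<A>. covering_family d r S C \<A>)"

lemma coveredI:
  fixes C :: nat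
  assumes "\<And>m. 1 \<le> m \<Longrightarrow> finite (\<A> m)" "\<And>m. 1 \<le> m \<Longrightarrow> card (\<A> m) \<le> C * m ^ r"
    and "\<And>m. 1 \<le> m \<Longrightarrow> S \<subseteq> \<Union>(\<A> m)"
    and "\<And>m A x y. 1 \<le> m \<Longrightarrow> A \<in> \<A> m \<Longrightarrow> x \<in> A \<Longrightarrow> y \<in> A \<Longrightarrow> d x y \<le> 1 / real m"
  shows "covered d r S"
  unfolding covered_def covering_family_def using assms by (intro exI[of _ C] exI[of _ \<A>]) blast

lemma covering_familyD:
  assumes "covering_family d r S C \<A>" "1 \<le> m"
  shows "finite (\<A> m)" "card (\<A> m) \<le> C * m ^ r" "S \<subseteq> \<Union>(\<A> m)"
    and "A \<in> \<A> m \<Longrightarrow> x \<in> A \<Longrightarrow> y \<in> A \<Longrightarrow> d x y \<le> 1 / real m"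
  using assms unfolding covering_family_def by blast+

lemma covered_mono:
  assumes "covered d r S" "r \<le> r'" "S' \<subseteq> S"
  shows "covered d r' S'"
proof -
  from assms(1) obtain C \<A> where "covering_family d r S C \<A>" unfolding covered_def by blast
  note \<A> = covering_familyD[OF this]
  show ?thesis
  proof (rule coveredI[where \<A> = \<A> and C = C])
    fix m :: nat assume m: "1 \<le> m"
    have "C * m ^ r \<le> C * m ^ r'" using assms(2) m by (intro mult_left_mono power_increasing) auto
    with \<A>(2)[OF m] show "card (\<A> m) \<le> C * m ^ r'" by (rule order_trans)
    show "S' \<subseteq> \<Union>(\<A> m)" using assms(3) \<A>(3)[OF m] by (rule order_trans)
  qed (fact \<A>(1,4))+
qed

lemma covered_point:
  assumes "\<And>x y. x \<in> S \<Longrightarrow> y \<in> S \<Longrightarrow> d x y \<le> 0"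
  shows "covered d 0 S"
proof (rule coveredI[where C = 1 and \<A> = "\<lambda>_. {S}"])
  fix m :: nat and A x y assume "A \<in> {S}" "x \<in> A" "y \<in> A"
  then have "d x y \<le> 0" using assms by blast
  then show "d x y \<le> 1 / real m" by (rule order_trans) simp
qed auto

lemma covered_empty: "covered d r {}"
  using covered_mono[OF covered_point[of "{}" d]] by simp

lemma covered_Un:
  assumes "covered d r S" "covered d r S'"
  shows "covered d r (S \<union> S')"
proof -
  from assms(1) obtain C \<A> where "covering_family d r S C \<A>" unfolding covered_def by blast
  note \<A> = covering_familyD[OF this]
  from assms(2) obtain C' \<B> where "covering_family d r S' C' \<B>" unfolding covered_def by blast
  note \<B> = covering_familyD[OF this]
  show ?thesis
  proof (rule coveredI[where C = "C + C'" and \<A> = "\<lambda>m. \<A> m \<union> \<B> m"])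
    fix m :: nat assume m: "1 \<le> m"
    show "finite (\<A> m \<union> \<B> m)" using \<A>(1)[OF m] \<B>(1)[OF m] by simp
    show "card (\<A> m \<union> \<B> m) \<le> (C + C') * m ^ r"
      using card_Un_le[of "\<A> m" "\<B> m"] \<A>(2)[OF m] \<B>(2)[OF m] by (simp add: distrib_right)
    show "S \<union> S' \<subseteq> \<Union>(\<A> m \<union> \<B> m)" using \<A>(3)[OF m] \<B>(3)[OF m] by blast
    show "d x y \<le> 1 / real m" if "A \<in> \<A> m \<union> \<B> m" "x \<in> A" "y \<in> A" for A x y
      using that \<A>(4)[OF m] \<B>(4)[OF m] by blast
  qed
qed

lemma covered_UN:
  assumes "finite I" "\<And>i. i \<in> I \<Longrightarrow> covered d r (S i)"
  shows "covered d r (\<Union>i\<in>I. S i)"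
  using assms by (induction I rule: finite_induct) (auto intro: covered_empty covered_Un)

text \<open>
  One additional Lipschitz parameter raises the dimension by one. Points are sorted by the piece of
  \<open>S'\<close> to which they are sent, at scale \<open>1 / (2 * m)\<close>, and by the position of the parameter on a grid of
  mesh \<open>1 / (2 * m * W)\<close>; either sorting contributes at most half of the distance \<open>1 / m\<close>.
\<close>

lemma covered_step:
  assumes cov: "covered d' r S'"
    and hit: "\<And>x. x \<in> S \<Longrightarrow> \<exists>s\<in>S'. \<exists>\<tau>\<in>{0..T}. P x s \<tau>"
    and lip: "\<And>x s \<tau> y s' \<sigma>. P x s \<tau> \<Longrightarrow> P y s' \<sigma> \<Longrightarrow> d x y \<le> d' s s' + V * \<bar>\<tau> - \<sigma>\<bar>"
  shows "covered d (Suc r) S"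
proof -
  from cov obtain C \<A> where "covering_family d' r S' C \<A>" unfolding covered_def by blast
  note \<A> = covering_familyD[OF this]
  define W where "W = nat \<lceil>V\<rceil> + 1"
  define U where "U = nat \<lceil>T\<rceil>"
  have W: "V \<le> real W" "1 \<le> W" unfolding W_def by linarith+
  have U: "T \<le> real U" unfolding U_def by linarith
  define K where "K m = 2 * m * W" for m :: nat
  define cell where "cell m = (\<lambda>(A, i). {x. \<exists>s\<in>A. \<exists>\<tau>\<in>{0..T}. P x s \<tau> \<and> nat \<lfloor>\<tau> * K m\<rfloor> = i})" for m
  show ?thesis
  proof (rule coveredI[where C = "C * 2 ^ r * (2 * W * U + 1)" and \<A> = "\<lambda>m. cell m ` (\<A> (2 * m) \<times> {..K m * U})"])
    fix m :: nat assume m: "1 \<le> m"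
    then have m2: "1 \<le> 2 * m" by simp
    have fin: "finite (\<A> (2 * m) \<times> {..K m * U})" using \<A>(1)[OF m2] by simp
    then show "finite (cell m ` (\<A> (2 * m) \<times> {..K m * U}))" by simp
    show "S \<subseteq> \<Union>(cell m ` (\<A> (2 * m) \<times> {..K m * U}))"
    proof
      fix x assume "x \<in> S"
      then obtain s \<tau> where s: "s \<in> S'" "\<tau> \<in> {0..T}" "P x s \<tau>" using hit by blast
      then obtain A where A: "A \<in> \<A> (2 * m)" "s \<in> A" using \<A>(3)[OF m2] by blast
      have "\<tau> * K m \<le> real U * real (K m)" using s U by (intro mult_right_mono) auto
      then have "nat \<lfloor>\<tau> * K m\<rfloor> \<le> K m * U" by (simp add: nat_le_iff floor_le_iff mult.commute)
      moreover have "x \<in> cell m (A, nat \<lfloor>\<tau> * K m\<rfloor>)" using s A unfolding cell_def prod.case by blast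
      ultimately show "x \<in> \<Union>(cell m ` (\<A> (2 * m) \<times> {..K m * U}))"
        using A by (intro UN_I[of "(A, nat \<lfloor>\<tau> * K m\<rfloor>)"]) auto
    qed
    have "card (cell m ` (\<A> (2 * m) \<times> {..K m * U})) \<le> card (\<A> (2 * m) \<times> {..K m * U})"
      using fin by (rule card_image_le)
    also have "\<dots> = card (\<A> (2 * m)) * (K m * U + 1)" by (simp add: card_cartesian_product)
    also have "\<dots> \<le> (C * (2 * m) ^ r) * ((2 * W * U + 1) * m)"
      using \<A>(2)[OF m2] m by (intro mult_mono) (auto simp: K_def algebra_simps)
    also have "\<dots> = C * 2 ^ r * (2 * W * U + 1) * m ^ Suc r"
      by (simp add: power_mult_distrib algebra_simps)
    finally show "card (cell m ` (\<A> (2 * m) \<times> {..K m * U})) \<le> C * 2 ^ r * (2 * W * U + 1) * m ^ Suc r" .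
    fix B x y assume "B \<in> cell m ` (\<A> (2 * m) \<times> {..K m * U})" and xy: "x \<in> B" "y \<in> B"
    then obtain A i where A: "A \<in> \<A> (2 * m)" and B: "B = cell m (A, i)" by blast
    obtain s \<tau> where s: "s \<in> A" "0 \<le> \<tau>" "P x s \<tau>" "nat \<lfloor>\<tau> * K m\<rfloor> = i"
      using xy(1) unfolding B cell_def by auto
    obtain s' \<sigma> where s': "s' \<in> A" "0 \<le> \<sigma>" "P y s' \<sigma>" "nat \<lfloor>\<sigma> * K m\<rfloor> = i"
      using xy(2) unfolding B cell_def by auto
    have "0 \<le> \<tau> * K m" "0 \<le> \<sigma> * K m" using s s' by auto
    then have "\<lfloor>\<tau> * K m\<rfloor> = \<lfloor>\<sigma> * K m\<rfloor>" using s(4) s'(4) by (metis eq_nat_nat_iff zero_le_floor)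
    then have "\<bar>\<tau> * K m - \<sigma> * K m\<bar> \<le> 1" by linarith
    then have "\<bar>\<tau> - \<sigma>\<bar> * K m \<le> 1" by (simp add: abs_mult left_diff_distrib[symmetric])
    then have "2 * m * (real W * \<bar>\<tau> - \<sigma>\<bar>) \<le> 1" by (simp add: K_def algebra_simps)
    then have "real W * \<bar>\<tau> - \<sigma>\<bar> \<le> 1 / (2 * m)" using m by (simp add: field_simps)
    moreover have "V * \<bar>\<tau> - \<sigma>\<bar> \<le> real W * \<bar>\<tau> - \<sigma>\<bar>" using W by (intro mult_right_mono) auto
    moreover have "d' s s' \<le> 1 / real (2 * m)" by (rule \<A>(4)[OF m2 A s(1) s'(1)])
    moreover have "d x y \<le> d' s s' + V * \<bar>\<tau> - \<sigma>\<bar>" by (rule lip[OF s(3) s'(3)])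
    moreover have "1 / real (2 * m) + 1 / real (2 * m) = 1 / real m" using m by (simp add: field_simps)
    ultimately show "d x y \<le> 1 / real m" by simp
  qed
qed

text \<open>
  The image of a covered set under a nonexpansive relation is covered.
\<close>

lemma covered_transfer:
  assumes cov: "covered d' r S'" and hit: "\<And>x. x \<in> S \<Longrightarrow> \<exists>s\<in>S'. P x s"
    and le: "\<And>x s y s'. P x s \<Longrightarrow> P y s' \<Longrightarrow> d x y \<le> d' s s'"
  shows "covered d r S"
proof -
  from cov obtain C \<A> where "covering_family d' r S' C \<A>" unfolding covered_def by blast
  note \<A> = covering_familyD[OF this]
  define cell where "cell A = {x. \<exists>s\<in>A. P x s}" for A
  show ?thesis
  proof (rule coveredI[where C = C and \<A> = "\<lambda>m. cell ` \<A> m"])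
    fix m :: nat assume m: "1 \<le> m"
    show "finite (cell ` \<A> m)" using \<A>(1)[OF m] by simp
    show "card (cell ` \<A> m) \<le> C * m ^ r"
      using card_image_le[OF \<A>(1)[OF m]] \<A>(2)[OF m] by (rule order_trans)
    show "S \<subseteq> \<Union>(cell ` \<A> m)"
    proof
      fix x assume "x \<in> S"
      then obtain s where "s \<in> S'" "P x s" using hit by blast
      then obtain A where "A \<in> \<A> m" "s \<in> A" using \<A>(3)[OF m] by blast
      with \<open>P x s\<close> show "x \<in> \<Union>(cell ` \<A> m)" by (auto simp: cell_def)
    qed
    fix B x y assume "B \<in> cell ` \<A> m" "x \<in> B" "y \<in> B"
    then obtain A s s' where A: "A \<in> \<A> m" "s \<in> A" "s' \<in> A" "P x s" "P y s'" by (auto simp: cell_def)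
    have "d x y \<le> d' s s'" by (rule le[OF A(4,5)])
    also have "\<dots> \<le> 1 / real m" by (rule \<A>(4)[OF m A(1-3)])
    finally show "d x y \<le> 1 / real m" .
  qed
qed

text \<open>
  The graph of a nonexpansive function on a bounded box has the dimension of the box, by a grid of
  mesh \<open>1 / m\<close> in the free coordinates.
\<close>

lemma covered_bounded_graph:
  assumes J: "finite J"
    and bounded: "\<And>x k. x \<in> S \<Longrightarrow> k \<in> J \<Longrightarrow> 0 \<le> x k \<and> x k \<le> real B"
    and graph: "\<And>x y e. x \<in> S \<Longrightarrow> y \<in> S \<Longrightarrow> 0 \<le> e \<Longrightarrow> \<forall>k\<in>J. \<bar>x k - y k\<bar> \<le> e \<Longrightarrow> d x y \<le> e"
  shows "covered d (card J) S"
proof -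
  define index where "index m x k = nat \<lfloor>x k * real m\<rfloor>" for m and x :: "'a \<Rightarrow> real" and k
  define cell where "cell m c = {x \<in> S. \<forall>k\<in>J. index m x k = c k}" for m c
  define L where "L m = (\<Pi>\<^sub>E k\<in>J. {..B * m})" for m
  have fin: "finite (L m)" for m unfolding L_def by (intro finite_PiE J) simp
  show ?thesis
  proof (rule coveredI[where C = "(B + 1) ^ card J" and \<A> = "\<lambda>m. cell m ` L m"])
    fix m :: nat assume m: "1 \<le> m"
    show "finite (cell m ` L m)" using fin by simp
    show "S \<subseteq> \<Union>(cell m ` L m)"
    proof
      fix x assume x: "x \<in> S"
      have "index m x k \<le> B * m" if "k \<in> J" for k
      proof -
        have "x k * m \<le> real B * real m" using bounded[OF x that] by (intro mult_right_mono) auto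
        then show ?thesis by (simp add: index_def nat_le_iff floor_le_iff)
      qed
      then have "restrict (index m x) J \<in> L m" by (auto simp: L_def)
      moreover have "x \<in> cell m (restrict (index m x) J)" using x by (simp add: cell_def)
      ultimately show "x \<in> \<Union>(cell m ` L m)" by blast
    qed
    have "card (cell m ` L m) \<le> card (L m)" using fin by (rule card_image_le)
    also have "\<dots> = (B * m + 1) ^ card J" unfolding L_def by (subst card_PiE[OF J]) simp
    also have "\<dots> \<le> ((B + 1) * m) ^ card J" using m by (intro power_mono) auto
    finally show "card (cell m ` L m) \<le> (B + 1) ^ card J * m ^ card J" by (simp only: power_mult_distrib)
    fix A x y assume "A \<in> cell m ` L m" "x \<in> A" "y \<in> A"
    then obtain c where x: "x \<in> cell m c" and y: "y \<in> cell m c" by blast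
    show "d x y \<le> 1 / real m"
    proof (rule graph)
      show "x \<in> S" "y \<in> S" using x y by (auto simp: cell_def)
      show "\<forall>k\<in>J. \<bar>x k - y k\<bar> \<le> 1 / real m"
      proof
        fix k assume k: "k \<in> J"
        have "0 \<le> x k" "0 \<le> y k" using bounded[OF \<open>x \<in> S\<close> k] bounded[OF \<open>y \<in> S\<close> k] by auto
        then have "0 \<le> x k * m" "0 \<le> y k * m" by auto
        moreover have "nat \<lfloor>x k * m\<rfloor> = nat \<lfloor>y k * m\<rfloor>" using x y k by (simp add: cell_def index_def)
        ultimately have "\<lfloor>x k * m\<rfloor> = \<lfloor>y k * m\<rfloor>" by (metis eq_nat_nat_iff zero_le_floor)
        then have "\<bar>x k * m - y k * m\<bar> \<le> 1" by linarith
        then have "\<bar>x k - y k\<bar> * m \<le> 1" by (simp add: abs_mult left_diff_distrib[symmetric])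
        then show "\<bar>x k - y k\<bar> \<le> 1 / real m" using m by (simp add: field_simps)
      qed
    qed simp
  qed
qed

definition sup_dist :: "'i set \<Rightarrow> ('i \<Rightarrow> real) \<Rightarrow> ('i \<Rightarrow> real) \<Rightarrow> real" where
  "sup_dist I x y = Max ((\<lambda>k. \<bar>x k - y k\<bar>) ` I)"

text \<open>
  About \<open>m ^ r\<close> cubes of side \<open>2 / m\<close> have a total volume of the order of \<open>m ^ r / m ^ card I\<close>, which
  vanishes as \<open>m\<close> grows. The set itself may fail to be measurable, so it is enclosed in the
  intersection of these coverings.
\<close>

lemma AE_not_in_covered:
  assumes I: "finite I" and cov: "covered (sup_dist I) r S" and r: "r < card I"
  shows "AE x in (\<Pi>\<^sub>M k\<in>I. (lborel :: real measure)). x \<notin> S"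
proof -
  interpret product_sigma_finite "\<lambda>_::'a. lborel :: real measure" ..
  let ?M = "\<Pi>\<^sub>M k\<in>I. (lborel :: real measure)"
  from cov obtain C \<A> where "covering_family (sup_dist I) r S C \<A>" unfolding covered_def by blast
  note \<A> = covering_familyD[OF this]
  define K where "K = real C * 2 ^ card I"
  have "\<exists>U. U \<in> sets ?M \<and> S \<inter> space ?M \<subseteq> U \<and> emeasure ?M U \<le> ennreal (K / real m)" if m: "1 \<le> m" for m
  proof -
    define pick where "pick A = (SOME a. a \<in> A)" for A :: "('a \<Rightarrow> real) set"
    define box where "box A = (\<Pi>\<^sub>E k\<in>I. {pick A k - 1 / real m..pick A k + 1 / real m})" for A
    have box_sets: "box A \<in> sets ?M" for A unfolding box_def using I by (intro sets_PiM_I_finite) auto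
    have "emeasure ?M (box A) = ennreal ((2 / m) ^ card I)" for A
    proof -
      have "emeasure ?M (box A) = (\<Prod>k\<in>I. emeasure lborel {pick A k - 1 / real m..pick A k + 1 / real m})"
        unfolding box_def using I by (intro emeasure_PiM) auto
      also have "\<dots> = (\<Prod>k\<in>I. ennreal (2 / m))"
        by (intro prod.cong) auto
      also have "\<dots> = ennreal ((2 / m) ^ card I)" by (simp add: ennreal_power)
      finally show ?thesis .
    qed
    then have "emeasure ?M (\<Union>A\<in>\<A> m. box A) \<le> (\<Sum>A\<in>\<A> m. ennreal ((2 / m) ^ card I))"
      using emeasure_subadditive_finite[OF \<A>(1)[OF m], of box ?M] box_sets by auto
    also have "\<dots> = ennreal (real (card (\<A> m)) * (2 / m) ^ card I)"
      by (simp add: ennreal_mult ennreal_of_nat_eq_real_of_nat)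
    also have "\<dots> \<le> ennreal (K / m)"
    proof (rule ennreal_leI)
      have "real (card (\<A> m)) \<le> real (C * m ^ r)" using \<A>(2)[OF m] by (rule of_nat_mono)
      then have "real (card (\<A> m)) * (2 / m) ^ card I \<le> (real C * real m ^ r) * (2 / m) ^ card I"
        by (intro mult_right_mono) auto
      also have "\<dots> = K * (real m ^ r / real m ^ card I)" by (simp add: K_def power_divide)
      also have "\<dots> \<le> K * (1 / m)"
      proof (rule mult_left_mono)
        have "real m ^ Suc r \<le> real m ^ card I" using m r by (intro power_increasing) auto
        then show "real m ^ r / real m ^ card I \<le> 1 / m" using m by (simp add: field_simps)
      qed (simp add: K_def)
      finally show "real (card (\<A> m)) * (2 / m) ^ card I \<le> K / m" by simp
    qed
    finally have "emeasure ?M (\<Union>A\<in>\<A> m. box A) \<le> ennreal (K / m)" .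
    moreover have "S \<inter> space ?M \<subseteq> (\<Union>A\<in>\<A> m. box A)"
    proof
      fix x assume x: "x \<in> S \<inter> space ?M"
      then obtain A where A: "A \<in> \<A> m" "x \<in> A" using \<A>(3)[OF m] by blast
      then have "pick A \<in> A" unfolding pick_def by (metis someI)
      with A have "sup_dist I x (pick A) \<le> 1 / m" by (intro \<A>(4)[OF m])
      moreover have "\<bar>x k - pick A k\<bar> \<le> sup_dist I x (pick A)" if "k \<in> I" for k
        unfolding sup_dist_def using I that by (intro Max_ge) auto
      ultimately have "\<bar>x k - pick A k\<bar> \<le> 1 / m" if "k \<in> I" for k using that order_trans by blast
      then have "x \<in> box A" using x
        by (auto simp: box_def space_PiM PiE_iff abs_le_iff algebra_simps)
      with A show "x \<in> (\<Union>A\<in>\<A> m. box A)" by blast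
    qed
    moreover have "(\<Union>A\<in>\<A> m. box A) \<in> sets ?M" using \<A>(1)[OF m] box_sets by blast
    ultimately show ?thesis by blast
  qed
  then have "\<forall>n. \<exists>U. U \<in> sets ?M \<and> S \<inter> space ?M \<subseteq> U \<and> emeasure ?M U \<le> ennreal (K / real (Suc n))"
    by (metis Suc_eq_plus1_left le_add1)
  then obtain U where U: "\<And>n. U n \<in> sets ?M" "\<And>n. S \<inter> space ?M \<subseteq> U n"
    "\<And>n. emeasure ?M (U n) \<le> ennreal (K / real (Suc n))" by metis
  define Z where "Z = (\<Inter>n. U n)"
  have Z: "Z \<in> sets ?M" unfolding Z_def using U(1) by (intro sets.countable_INT) auto
  have "emeasure ?M Z \<le> ennreal (K / real (Suc n))" for n
    using emeasure_mono[of Z "U n" ?M] U(1,3)[of n] unfolding Z_def by (auto intro: order_trans)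
  moreover have "(\<lambda>n. ennreal (K / real (Suc n))) \<longlonglongrightarrow> ennreal 0"
    by (intro tendsto_ennrealI LIMSEQ_Suc lim_const_over_n)
  ultimately have "emeasure ?M Z \<le> ennreal 0" by (intro LIMSEQ_le_const) auto
  with Z have "Z \<in> null_sets ?M" by (simp add: null_sets_def)
  then show ?thesis
  proof (rule AE_I')
    show "{x \<in> space ?M. \<not> x \<notin> S} \<subseteq> Z" using U(2) by (auto simp: Z_def)
  qed
qed

section \<open>Increasing coupling: motions that never synchronize\<close>

text \<open>
  The distance of two states modulo a common rotation of all oscillators.
\<close>

definition phase_dist :: "nat \<Rightarrow> (nat \<Rightarrow> real) \<Rightarrow> (nat \<Rightarrow> real) \<Rightarrow> real" where
  "phase_dist N x y = spread {1..N} (\<lambda>k. x k - y k)"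

lemma phase_dist_commute:
  assumes "1 \<le> N"
  shows "phase_dist N x y = phase_dist N y x"
  unfolding phase_dist_def using assms by (intro spread_minus) auto

lemma phase_dist_triangle:
  assumes "1 \<le> N"
  shows "phase_dist N x z \<le> phase_dist N x y + phase_dist N y z"
  using spread_add[of "{1..N}" "\<lambda>k. x k - y k" "\<lambda>k. y k - z k"] assms by (simp add: phase_dist_def)

lemma phase_dist_le:
  assumes "1 \<le> N" and "cone_at N \<theta> t" "cone_at N \<psi> s"
  shows "phase_dist N (\<lambda>k. \<theta> k t) (\<lambda>k. \<psi> k s) \<le> 4 * pi"
  unfolding phase_dist_def
proof (rule spread_leI)
  fix j k assume jk: "j \<in> {1..N}" "k \<in> {1..N}"
  have range: "0 \<le> phase_diff N \<phi> (i - 1) r" "phase_diff N \<phi> (i - 1) r \<le> 2 * pi"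
    if "cone_at N \<phi> r" "i \<in> {1..N}" for \<phi> i r
    using phase_diff_mono[OF that(1), of 0 "i - 1"] phase_diff_mono[OF that(1), of "i - 1" N] that(2)
    by (auto simp: phase_diff_ends[OF assms(1)])
  have "\<theta> j t - \<theta> k t \<le> 2 * pi" "\<psi> k s - \<psi> j s \<le> 2 * pi"
    using range[OF assms(2) jk(1)] range[OF assms(2) jk(2)] range[OF assms(3) jk(1)] range[OF assms(3) jk(2)]
    unfolding phase_difference[OF jk, of \<psi>] phase_difference[OF jk(2,1), of \<theta>] by linarith+
  then show "\<theta> j t - \<psi> j s - (\<theta> k t - \<psi> k s) \<le> 4 * pi" by linarith
qed (use assms in auto)

text \<open>
  The interval is half-open so that \<open>b\<close> may be the time at which the motion leaves the open face.
\<close>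

definition face_orbit :: "nat \<Rightarrow> real \<Rightarrow> (real \<Rightarrow> real) \<Rightarrow> nat set \<Rightarrow> real \<Rightarrow> (nat \<Rightarrow> real \<Rightarrow> real) \<Rightarrow> bool" where
  "face_orbit N \<omega> \<Gamma> Z b \<theta> \<longleftrightarrow>
     network_solution N \<omega> \<Gamma> \<theta> \<and> cone_at N \<theta> 0 \<and> (\<forall>t\<in>{0..<b}. collapsed N \<theta> t = Z)"

text \<open>
  The starting states in the open face \<open>Z\<close> of motions that make their last collision no later than \<open>T\<close>
  while at least two clusters survive; full synchronization means that \<open>N - 1\<close> of the \<open>N\<close> gaps are
  collapsed. The bound \<open>T\<close> keeps all passage times in a compact interval, so that coverings by
  finitely many sets exist.
\<close>

definition stuck :: "nat \<Rightarrow> real \<Rightarrow> (real \<Rightarrow> real) \<Rightarrow> real \<Rightarrow> nat set \<Rightarrow> (nat \<Rightarrow> real) set" where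
  "stuck N \<omega> \<Gamma> T Z = {x. \<exists>\<theta>. network_solution N \<omega> \<Gamma> \<theta> \<and> cone_at N \<theta> 0 \<and> x = (\<lambda>k. \<theta> k 0) \<and>
     collapsed N \<theta> 0 = Z \<and> (\<forall>t\<ge>T. collapsed N \<theta> t = collapsed N \<theta> T) \<and> card (collapsed N \<theta> T) + 2 \<le> N}"

context
  fixes N :: nat and \<omega> :: real and \<Gamma> :: "real \<Rightarrow> real" and B :: real
  assumes N: "1 \<le> N" and inc: "increasing_coupling \<Gamma>" and bound: "\<And>x. x \<in> {- (2 * pi)..2 * pi} \<Longrightarrow> \<bar>\<Gamma> x\<bar> \<le> B"
begin

lemma phase_speed:
  assumes sol: "network_solution N \<omega> \<Gamma> \<theta>" and cone: "cone_at N \<theta> 0" and ab: "0 \<le> a" "a \<le> b"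
  shows "phase_dist N (\<lambda>k. \<theta> k b) (\<lambda>k. \<theta> k a) \<le> 2 * N * B * (b - a)"
  unfolding phase_dist_def
proof (rule spread_leI)
  fix j k assume jk: "j \<in> {1..N}" "k \<in> {1..N}"
  define v where "v i t = \<omega> + (\<Sum>l\<in>{1..N} - {i}. \<Gamma> (\<theta> i t - \<theta> l t))" for i t
  have v: "\<bar>v i t - \<omega>\<bar> \<le> N * B" if i: "i \<in> {1..N}" and t: "0 \<le> t" for i t
  proof -
    have "\<bar>\<Gamma> (\<theta> i t - \<theta> l t)\<bar> \<le> B" if l: "l \<in> {1..N}" for l
    proof (rule bound)
      have c: "cone_at N \<theta> t" by (rule cone_at_forever[OF sol cone t])
      have "0 \<le> phase_diff N \<theta> (m - 1) t \<and> phase_diff N \<theta> (m - 1) t \<le> 2 * pi" if "m \<in> {1..N}" for m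
        using phase_diff_mono[OF c, of 0 "m - 1"] phase_diff_mono[OF c, of "m - 1" N] that
        by (auto simp: phase_diff_ends[OF N])
      from this[OF i] this[OF l] show "\<theta> i t - \<theta> l t \<in> {- (2 * pi)..2 * pi}"
        unfolding phase_difference[OF l i, of \<theta>] by auto
    qed
    then have "(\<Sum>l\<in>{1..N} - {i}. \<bar>\<Gamma> (\<theta> i t - \<theta> l t)\<bar>) \<le> card ({1..N} - {i}) * B"
      by (intro sum_bounded_above) auto
    also have "\<dots> \<le> N * B"
    proof (rule mult_right_mono)
      show "0 \<le> B" using bound[of 0] by simp
      show "real (card ({1..N} - {i})) \<le> N" using card_mono[of "{1..N}" "{1..N} - {i}"] by simp
    qed
    finally have "(\<Sum>l\<in>{1..N} - {i}. \<bar>\<Gamma> (\<theta> i t - \<theta> l t)\<bar>) \<le> N * B" .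
    with sum_abs[of "\<lambda>l. \<Gamma> (\<theta> i t - \<theta> l t)" "{1..N} - {i}"]
    have "\<bar>\<Sum>l\<in>{1..N} - {i}. \<Gamma> (\<theta> i t - \<theta> l t)\<bar> \<le> N * B" by (rule order_trans)
    then show ?thesis by (simp add: v_def)
  qed
  have "- (2 * N * B) * (b - a) \<le> Max ((\<lambda>_::unit. \<theta> k b - \<theta> j b) ` UNIV) - Max ((\<lambda>_::unit. \<theta> k a - \<theta> j a) ` UNIV)"
  proof (rule finite_max_grows[where f = "\<lambda>_ t. \<theta> k t - \<theta> j t" and D = "\<lambda>_ t. v k t - v j t"])
    show "continuous_on {a..b} (\<lambda>t. \<theta> k t - \<theta> j t)"
      using \<open>0 \<le> a\<close> by (intro continuous_intros continuous_on_subset[OF network_solutionD(1)[OF sol]] jk) auto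
    fix t assume "t \<in> {a..<b}"
    then have t: "0 \<le> t" using \<open>0 \<le> a\<close> by auto
    show "((\<lambda>t. \<theta> k t - \<theta> j t) has_real_derivative v k t - v j t) (at t within {t..})"
      unfolding v_def by (intro DERIV_diff network_solutionD(2)[OF sol] jk t)
    show "- (2 * N * B) \<le> v k t - v j t" using v[OF jk(1) t] v[OF jk(2) t] by (simp add: abs_le_iff)
  qed (use ab in auto)
  then show "\<theta> j b - \<theta> j a - (\<theta> k b - \<theta> k a) \<le> 2 * N * B * (b - a)" by simp
qed (use N in auto)

lemma phase_dist_expands:
  assumes sol: "network_solution N \<omega> \<Gamma> \<theta>" "network_solution N \<omega> \<Gamma> \<psi>"
    and cone: "cone_at N \<theta> 0" "cone_at N \<psi> 0" and b: "0 \<le> b"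
    and face: "\<And>t. t \<in> {0..<b} \<Longrightarrow> collapsed N \<theta> t = collapsed N \<psi> t"
    and gain: "coupling_gain \<Gamma> \<delta> \<mu>"
    and large: "\<And>t. t \<in> {0..<b} \<Longrightarrow> \<delta> \<le> phase_dist N (\<lambda>k. \<theta> k t) (\<lambda>k. \<psi> k t)"
  shows "phase_dist N (\<lambda>k. \<theta> k 0) (\<lambda>k. \<psi> k 0) + \<mu> * b \<le> phase_dist N (\<lambda>k. \<theta> k b) (\<lambda>k. \<psi> k b)"
  unfolding phase_dist_def
proof (rule spread_expands[OF N _ _ _ inc gain])
  show "branches_agree N b \<theta> \<psi>"
    unfolding branches_agree_def
  proof (intro ballI)
    fix t j k assume t: "t \<in> {0..<b}" and jk: "j \<in> {1..N}" "k \<in> {1..N}"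
    then have "0 \<le> t" by simp
    from same_branch_of_collapsed_eq[OF N cone_at_forever[OF sol(1) cone(1) this]
        cone_at_forever[OF sol(2) cone(2) this] face[OF t] jk]
    show "same_branch (\<theta> k t - \<theta> j t) (\<psi> k t - \<psi> j t)" .
  qed
qed (use network_solution_flow_on sol b large in \<open>auto simp: phase_dist_def\<close>)

lemma face_orbits_do_not_approach:
  assumes "face_orbit N \<omega> \<Gamma> Z b \<theta>" "face_orbit N \<omega> \<Gamma> Z b \<psi>" "0 \<le> b"
  shows "phase_dist N (\<lambda>k. \<theta> k 0) (\<lambda>k. \<psi> k 0) \<le> phase_dist N (\<lambda>k. \<theta> k b) (\<lambda>k. \<psi> k b)"
proof -
  have "0 \<le> phase_dist N x y" for x y unfolding phase_dist_def using N by (intro spread_nonneg) auto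
  then show ?thesis
    using phase_dist_expands[of \<theta> \<psi> b 0 0] assms coupling_gain_zero[OF inc] by (simp add: face_orbit_def)
qed

text \<open>
  A positive distance \<open>\<delta>\<close> would stay at least \<open>\<delta>\<close> and hence grow linearly, but distances of states in
  the cone are at most \<open>4 * pi\<close>.
\<close>

lemma face_orbits_forever_coincide:
  assumes "\<And>b. 0 \<le> b \<Longrightarrow> face_orbit N \<omega> \<Gamma> Z b \<theta>" "\<And>b. 0 \<le> b \<Longrightarrow> face_orbit N \<omega> \<Gamma> Z b \<psi>"
  shows "phase_dist N (\<lambda>k. \<theta> k 0) (\<lambda>k. \<psi> k 0) \<le> 0"
proof (rule ccontr)
  define \<delta> where "\<delta> = phase_dist N (\<lambda>k. \<theta> k 0) (\<lambda>k. \<psi> k 0)"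
  assume "\<not> phase_dist N (\<lambda>k. \<theta> k 0) (\<lambda>k. \<psi> k 0) \<le> 0"
  then have "\<delta> > 0" by (simp add: \<delta>_def)
  then obtain \<mu> where \<mu>: "\<mu> > 0" "coupling_gain \<Gamma> \<delta> \<mu>" using coupling_gain_positive[OF inc] by blast
  define b where "b = 4 * pi / \<mu>"
  have b: "0 \<le> b" using \<mu>(1) by (simp add: b_def)
  note orb = assms(1)[OF b, unfolded face_orbit_def] assms(2)[OF b, unfolded face_orbit_def]
  have "\<delta> + \<mu> * b \<le> phase_dist N (\<lambda>k. \<theta> k b) (\<lambda>k. \<psi> k b)"
    unfolding \<delta>_def
  proof (rule phase_dist_expands[OF _ _ _ _ b _ \<mu>(2)])
    show "\<delta> \<le> phase_dist N (\<lambda>k. \<theta> k t) (\<lambda>k. \<psi> k t)" if "t \<in> {0..<b}" for t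
      unfolding \<delta>_def using that by (intro face_orbits_do_not_approach[OF assms]) auto
  qed (use orb in auto)
  also have "\<dots> \<le> 4 * pi" using orb b cone_at_forever by (intro phase_dist_le N) blast+
  also have "\<dots> = \<mu> * b" using \<mu>(1) by (simp add: b_def)
  finally show False using \<open>\<delta> > 0\<close> by simp
qed

text \<open>
  Up to the earlier of the two exit times both motions are in the same face, where distances do not
  decrease; the remaining time is absorbed by the bound on the speed.
\<close>

lemma exit_estimate:
  assumes "face_orbit N \<omega> \<Gamma> Z \<tau> \<theta>" "face_orbit N \<omega> \<Gamma> Z \<sigma> \<psi>" "0 \<le> \<tau>" "0 \<le> \<sigma>"
  shows "phase_dist N (\<lambda>k. \<theta> k 0) (\<lambda>k. \<psi> k 0)
    \<le> phase_dist N (\<lambda>k. \<theta> k \<tau>) (\<lambda>k. \<psi> k \<sigma>) + 2 * N * B * \<bar>\<tau> - \<sigma>\<bar>"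
proof -
  have le: "phase_dist N (\<lambda>k. \<theta> k 0) (\<lambda>k. \<psi> k 0)
      \<le> phase_dist N (\<lambda>k. \<theta> k \<tau>) (\<lambda>k. \<psi> k \<sigma>) + 2 * N * B * \<bar>\<tau> - \<sigma>\<bar>"
    if orb: "face_orbit N \<omega> \<Gamma> Z \<tau> \<theta>" "face_orbit N \<omega> \<Gamma> Z \<sigma> \<psi>" and t: "0 \<le> \<tau>" "\<tau> \<le> \<sigma>" for \<theta> \<psi> \<tau> \<sigma>
  proof -
    have "face_orbit N \<omega> \<Gamma> Z \<tau> \<psi>" using orb(2) t unfolding face_orbit_def by auto
    from face_orbits_do_not_approach[OF orb(1) this t(1)]
    have "phase_dist N (\<lambda>k. \<theta> k 0) (\<lambda>k. \<psi> k 0) \<le> phase_dist N (\<lambda>k. \<theta> k \<tau>) (\<lambda>k. \<psi> k \<tau>)" .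
    also have "\<dots> \<le> phase_dist N (\<lambda>k. \<theta> k \<tau>) (\<lambda>k. \<psi> k \<sigma>) + phase_dist N (\<lambda>k. \<psi> k \<sigma>) (\<lambda>k. \<psi> k \<tau>)"
      by (rule phase_dist_triangle[OF N])
    also have "phase_dist N (\<lambda>k. \<psi> k \<sigma>) (\<lambda>k. \<psi> k \<tau>) \<le> 2 * N * B * (\<sigma> - \<tau>)"
      using orb(2) t by (intro phase_speed) (auto simp: face_orbit_def)
    finally show ?thesis using t by simp
  qed
  show ?thesis
  proof (cases "\<tau> \<le> \<sigma>")
    case True
    then show ?thesis by (intro le assms)
  next
    case False
    then have "phase_dist N (\<lambda>k. \<psi> k 0) (\<lambda>k. \<theta> k 0)
      \<le> phase_dist N (\<lambda>k. \<psi> k \<sigma>) (\<lambda>k. \<theta> k \<tau>) + 2 * N * B * \<bar>\<sigma> - \<tau>\<bar>" by (intro le assms) auto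
    then show ?thesis by (simp add: phase_dist_commute[OF N, of "\<lambda>k. \<psi> k _"] abs_minus_commute)
  qed
qed

lemma stuck_card:
  assumes "x \<in> stuck N \<omega> \<Gamma> T Z" "0 \<le> T"
  shows "card Z + 2 \<le> N"
proof -
  obtain \<theta> where \<theta>: "network_solution N \<omega> \<Gamma> \<theta>" "collapsed N \<theta> 0 = Z" "card (collapsed N \<theta> T) + 2 \<le> N"
    using assms(1) unfolding stuck_def by blast
  have "card Z \<le> card (collapsed N \<theta> T)"
    unfolding \<theta>(2)[symmetric] using \<open>0 \<le> T\<close>
    by (intro card_mono collapsed_mono[OF \<theta>(1)]) (auto simp: collapsed_def)
  with \<theta>(3) show ?thesis by simp
qed

text \<open>
  A stuck motion either keeps its collapsed gaps forever or reaches, at its first collision, a stuck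
  state of a smaller face.
\<close>

lemma stuck_decompose:
  assumes x: "x \<in> stuck N \<omega> \<Gamma> T Z" and T: "0 \<le> T"
  shows "(\<exists>\<theta>. x = (\<lambda>k. \<theta> k 0) \<and> (\<forall>b\<ge>0. face_orbit N \<omega> \<Gamma> Z b \<theta>)) \<or>
    (\<exists>Z'\<in>{Z'. Z \<subset> Z' \<and> Z' \<subseteq> {1..N}}. \<exists>s\<in>stuck N \<omega> \<Gamma> T Z'. \<exists>\<tau>\<in>{0..T}.
       \<exists>\<theta>. x = (\<lambda>k. \<theta> k 0) \<and> s = (\<lambda>k. \<theta> k \<tau>) \<and> face_orbit N \<omega> \<Gamma> Z \<tau> \<theta>)"
proof -
  obtain \<theta> where \<theta>: "network_solution N \<omega> \<Gamma> \<theta>" "cone_at N \<theta> 0" "x = (\<lambda>k. \<theta> k 0)" "collapsed N \<theta> 0 = Z"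
    "\<forall>t\<ge>T. collapsed N \<theta> t = collapsed N \<theta> T" "card (collapsed N \<theta> T) + 2 \<le> N"
    using x unfolding stuck_def by blast
  have later: "collapsed N \<theta> t = collapsed N \<theta> T" if "T \<le> t" for t using \<theta>(5) that by blast
  show ?thesis
  proof (cases "collapsed N \<theta> T = Z")
    case True
    have "collapsed N \<theta> t = Z" if "0 \<le> t" for t
    proof (cases "T \<le> t")
      case T_le: True
      show ?thesis unfolding later[OF T_le] by (rule True)
    next
      case False
      then have "collapsed N \<theta> 0 \<subseteq> collapsed N \<theta> t" "collapsed N \<theta> t \<subseteq> collapsed N \<theta> T"
        using that by (intro collapsed_mono[OF \<theta>(1)]; simp)+
      with True \<theta>(4) show ?thesis by blast
    qed
    with \<theta>(1,2) have "\<forall>b\<ge>0. face_orbit N \<omega> \<Gamma> Z b \<theta>" by (simp add: face_orbit_def)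
    with \<theta>(3) show ?thesis by blast
  next
    case False
    then obtain \<tau> where \<tau>: "0 \<le> \<tau>" "\<tau> \<le> T" "Z \<subset> collapsed N \<theta> \<tau>"
      "\<And>r. r \<in> {0..<\<tau>} \<Longrightarrow> collapsed N \<theta> r = Z"
      using first_collision[OF \<theta>(1) T] unfolding \<theta>(4) by blast
    have "face_orbit N \<omega> \<Gamma> Z \<tau> \<theta>" using \<theta>(1,2) \<tau>(4) by (simp add: face_orbit_def)
    moreover have "(\<lambda>k. \<theta> k \<tau>) \<in> stuck N \<omega> \<Gamma> T (collapsed N \<theta> \<tau>)"
      unfolding stuck_def
    proof (intro CollectI exI[of _ "\<lambda>k t. \<theta> k (\<tau> + t)"] conjI allI impI)
      have later': "collapsed N \<theta> (\<tau> + t) = collapsed N \<theta> T" if "T \<le> t" for t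
        by (rule later) (use that \<tau>(1) in simp)
      show "network_solution N \<omega> \<Gamma> (\<lambda>k t. \<theta> k (\<tau> + t))" by (rule network_solution_shift[OF \<theta>(1) \<tau>(1)])
      show "cone_at N (\<lambda>k t. \<theta> k (\<tau> + t)) 0"
        unfolding shift_simps by (rule cone_at_forever[OF \<theta>(1,2)]) (use \<tau>(1) in simp)
      show "collapsed N (\<lambda>k t. \<theta> k (\<tau> + t)) 0 = collapsed N \<theta> \<tau>" unfolding shift_simps by simp
      show "collapsed N (\<lambda>k t. \<theta> k (\<tau> + t)) t = collapsed N (\<lambda>k t. \<theta> k (\<tau> + t)) T" if "T \<le> t" for t
        unfolding shift_simps later'[OF that] later'[OF order_refl] ..
      show "card (collapsed N (\<lambda>k t. \<theta> k (\<tau> + t)) T) + 2 \<le> N"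
        unfolding shift_simps later'[OF order_refl] by (rule \<theta>(6))
    qed simp
    moreover have "collapsed N \<theta> \<tau> \<subseteq> {1..N}" unfolding collapsed_def by blast
    moreover have "\<tau> \<in> {0..T}" using \<tau>(1,2) by simp
    ultimately show ?thesis using \<theta>(3) \<tau>(3)
      by (intro disjI2 bexI[of _ "collapsed N \<theta> \<tau>"] bexI[of _ "\<lambda>k. \<theta> k \<tau>"] bexI[of _ \<tau>] exI[of _ \<theta>] conjI) simp_all
  qed
qed

text \<open>
  Induction from small faces to large ones. The face \<open>Z\<close> has dimension \<open>N - 1 - card Z\<close>, one more
  than the claimed dimension of its stuck states. States that never leave the face form at most one point
  up to rotation; the others arise by \<open>covered_step\<close> from the stuck states of smaller faces.
\<close>

lemma stuck_covered:
  assumes "0 \<le> T" "Z \<subseteq> {1..N}"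
  shows "covered (phase_dist N) (N - 2 - card Z) (stuck N \<omega> \<Gamma> T Z)"
  using assms(2)
proof (induction "N - card Z" arbitrary: Z rule: less_induct)
  case less
  define stay where "stay = {x. \<exists>\<theta>. x = (\<lambda>k. \<theta> k 0) \<and> (\<forall>b\<ge>0. face_orbit N \<omega> \<Gamma> Z b \<theta>)}"
  define P where "P x s \<tau> \<longleftrightarrow> 0 \<le> \<tau> \<and> (\<exists>\<theta>. x = (\<lambda>k. \<theta> k 0) \<and> s = (\<lambda>k. \<theta> k \<tau>) \<and> face_orbit N \<omega> \<Gamma> Z \<tau> \<theta>)" for x s \<tau>
  define exits where "exits Z' = {x. \<exists>s\<in>stuck N \<omega> \<Gamma> T Z'. \<exists>\<tau>\<in>{0..T}. P x s \<tau>}" for Z'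
  define larger where "larger = {Z'. Z \<subset> Z' \<and> Z' \<subseteq> {1..N}}"
  have "covered (phase_dist N) 0 stay"
    by (rule covered_point) (auto simp: stay_def intro: face_orbits_forever_coincide)
  then have "covered (phase_dist N) (N - 2 - card Z) stay" by (rule covered_mono) auto
  moreover have "covered (phase_dist N) (N - 2 - card Z) (\<Union>Z'\<in>larger. exits Z')"
  proof (rule covered_UN)
    show "finite larger" unfolding larger_def by (rule finite_subset[of _ "Pow {1..N}"]) auto
    fix Z' assume Z': "Z' \<in> larger"
    have fin: "finite Z'" using Z' unfolding larger_def by (blast intro: finite_subset)
    then have card: "card Z < card Z'" using Z' unfolding larger_def by (intro psubset_card_mono) auto
    show "covered (phase_dist N) (N - 2 - card Z) (exits Z')"
    proof (cases "card Z' + 2 \<le> N")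
      case True
      have "covered (phase_dist N) (N - 2 - card Z') (stuck N \<omega> \<Gamma> T Z')"
        using True card Z' by (intro less.hyps) (auto simp: larger_def)
      then have "covered (phase_dist N) (Suc (N - 2 - card Z')) (exits Z')"
      proof (rule covered_step[where P = P])
        show "\<exists>s\<in>stuck N \<omega> \<Gamma> T Z'. \<exists>\<tau>\<in>{0..T}. P x s \<tau>" if "x \<in> exits Z'" for x
          using that unfolding exits_def by blast
        show "phase_dist N x y \<le> phase_dist N s s' + 2 * N * B * \<bar>\<tau> - \<sigma>\<bar>" if "P x s \<tau>" "P y s' \<sigma>" for x s \<tau> y s' \<sigma>
          using that exit_estimate unfolding P_def by blast
      qed
      then show ?thesis using True card by (elim covered_mono) auto
    next
      case False
      then have "exits Z' = {}" using stuck_card assms(1) unfolding exits_def by blast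
      then show ?thesis by (simp add: covered_empty)
    qed
  qed
  ultimately have "covered (phase_dist N) (N - 2 - card Z) (stay \<union> (\<Union>Z'\<in>larger. exits Z'))" by (rule covered_Un)
  then show ?case
  proof (rule covered_mono[OF _ order_refl])
    show "stuck N \<omega> \<Gamma> T Z \<subseteq> stay \<union> (\<Union>Z'\<in>larger. exits Z')"
    proof
      fix x assume "x \<in> stuck N \<omega> \<Gamma> T Z"
      from stuck_decompose[OF this assms(1)] show "x \<in> stay \<union> (\<Union>Z'\<in>larger. exits Z')"
      proof
        assume "\<exists>Z'\<in>{Z'. Z \<subset> Z' \<and> Z' \<subseteq> {1..N}}. \<exists>s\<in>stuck N \<omega> \<Gamma> T Z'. \<exists>\<tau>\<in>{0..T}.
          \<exists>\<theta>. x = (\<lambda>k. \<theta> k 0) \<and> s = (\<lambda>k. \<theta> k \<tau>) \<and> face_orbit N \<omega> \<Gamma> Z \<tau> \<theta>"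
        then obtain Z' s \<tau> where *: "Z' \<in> larger" "s \<in> stuck N \<omega> \<Gamma> T Z'" "\<tau> \<in> {0..T}"
          "\<exists>\<theta>. x = (\<lambda>k. \<theta> k 0) \<and> s = (\<lambda>k. \<theta> k \<tau>) \<and> face_orbit N \<omega> \<Gamma> Z \<tau> \<theta>"
          unfolding larger_def by blast
        from *(3,4) have "P x s \<tau>" unfolding P_def by simp
        with * show ?thesis unfolding exits_def by blast
      qed (simp add: stay_def)
    qed
  qed
qed

end

section \<open>Almost every initial condition\<close>

text \<open>
  The factor \<open>c\<close> is \<open>1\<close> for increasing and \<open>- 1\<close> for decreasing coupling functions.
\<close>

lemma increasing_coupling_of_deriv:
  assumes \<Gamma>: "coupling_function \<Gamma>" and pos: "\<And>x. x \<in> {0<..<2 * pi} \<Longrightarrow> 0 < c * deriv \<Gamma> x"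
  shows "increasing_coupling (\<lambda>x. c * \<Gamma> x)"
  unfolding increasing_coupling_def
proof
  show "\<forall>x. c * \<Gamma> (x + 2 * pi) = c * \<Gamma> x" using \<Gamma> by (simp add: coupling_function_def)
  show "strict_mono_on {0<..<2 * pi} (\<lambda>x. c * \<Gamma> x)"
  proof (rule strict_mono_onI)
    fix r s :: real assume rs: "r \<in> {0<..<2 * pi}" "s \<in> {0<..<2 * pi}" "r < s"
    show "c * \<Gamma> r < c * \<Gamma> s"
    proof (rule DERIV_pos_imp_increasing[OF rs(3)])
      fix x assume "r \<le> x" "x \<le> s"
      then have x: "x \<in> {0<..<2 * pi}" using rs by auto
      then have "\<Gamma> differentiable at x"
        using \<Gamma> by (simp add: coupling_function_def differentiable_on_eq_differentiable_at)
      then have "(\<Gamma> has_real_derivative deriv \<Gamma> x) (at x)" by (simp add: DERIV_deriv_iff_real_differentiable)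
      then have "((\<lambda>x. c * \<Gamma> x) has_real_derivative c * deriv \<Gamma> x) (at x)" by (rule DERIV_cmult)
      with pos[OF x] show "\<exists>y. ((\<lambda>x. c * \<Gamma> x) has_real_derivative y) (at x) \<and> 0 < y" by blast
    qed
  qed
qed

text \<open>
  By monotonicity the one-sided limits at the ends bound \<open>\<Gamma>\<close> on the whole open interval.
\<close>

lemma increasing_coupling_bounded:
  assumes \<Gamma>: "coupling_function \<Gamma>" and inc: "increasing_coupling \<Gamma>"
  obtains B where "\<And>x. x \<in> {- (2 * pi)..2 * pi} \<Longrightarrow> \<bar>\<Gamma> x\<bar> \<le> B"
proof -
  obtain l u where lu: "(\<Gamma> \<longlongrightarrow> l) (at_right 0)" "(\<Gamma> \<longlongrightarrow> u) (at_left (2 * pi))"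
    using \<Gamma> by (auto simp: coupling_function_def)
  have mono: "\<Gamma> x < \<Gamma> y" if "0 < x" "x < y" "y < 2 * pi" for x y
    using inc that by (intro strict_mono_onD[of "{0<..<2 * pi}" \<Gamma>]) (auto simp: increasing_coupling_def)
  have per: "\<Gamma> (x + 2 * pi) = \<Gamma> x" for x using inc by (simp add: increasing_coupling_def)
  have lower: "l - 1 \<le> \<Gamma> x" if x: "0 < x" "x < 2 * pi" for x
  proof -
    have "\<forall>\<^sub>F y in at_right 0. l - 1 < \<Gamma> y" using lu(1) by (rule order_tendstoD) simp
    moreover have "\<forall>\<^sub>F y in at_right 0. y \<in> {0<..<x}" using x by (intro eventually_at_right_real)
    ultimately have "\<forall>\<^sub>F y in at_right 0. l - 1 < \<Gamma> y \<and> y \<in> {0<..<x}" by eventually_elim simp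
    then obtain y where "l - 1 < \<Gamma> y" "0 < y" "y < x"
      using eventually_happens[of _ "at_right (0::real)"] by force
    with mono[of y x] x show ?thesis by simp
  qed
  have upper: "\<Gamma> x \<le> u + 1" if x: "0 < x" "x < 2 * pi" for x
  proof -
    have "\<forall>\<^sub>F y in at_left (2 * pi). \<Gamma> y < u + 1" using lu(2) by (rule order_tendstoD) simp
    moreover have "\<forall>\<^sub>F y in at_left (2 * pi). y \<in> {x<..<2 * pi}" using x by (intro eventually_at_left_real)
    ultimately have "\<forall>\<^sub>F y in at_left (2 * pi). \<Gamma> y < u + 1 \<and> y \<in> {x<..<2 * pi}" by eventually_elim simp
    then obtain y where "\<Gamma> y < u + 1" "x < y" "y < 2 * pi"
      using eventually_happens[of _ "at_left (2 * pi)"] by force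
    with mono[of x y] x show ?thesis by simp
  qed
  define B where "B = \<bar>\<Gamma> 0\<bar> + \<bar>l - 1\<bar> + \<bar>u + 1\<bar>"
  have inside: "\<bar>\<Gamma> x\<bar> \<le> B" if "0 \<le> x" "x < 2 * pi" for x
  proof (cases "x = 0")
    case False
    with lower[of x] upper[of x] that show ?thesis by (simp add: B_def abs_le_iff) linarith
  qed (simp add: B_def)
  have "\<bar>\<Gamma> x\<bar> \<le> B" if x: "x \<in> {- (2 * pi)..2 * pi}" for x
  proof -
    consider "x < 0" | "x = 2 * pi" | "0 \<le> x \<and> x < 2 * pi" using x by (cases "x = 2 * pi"; cases "x < 0") auto
    then show ?thesis
    proof cases
      case 1
      with x inside[of "x + 2 * pi"] show ?thesis by (simp add: per)
    next
      case 2
      with inside[of 0] per[of 0] show ?thesis by simp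
    next
      case 3
      with inside[of x] show ?thesis by simp
    qed
  qed
  then show ?thesis by (rule that)
qed

text \<open>
  A vector of phase differences completed by the end values \<open>0\<close> and \<open>2 * pi\<close>, as in \<open>phase_diff\<close>, so
  that all faces of the cone have the same form.
\<close>

definition extended_diff :: "nat \<Rightarrow> (nat \<Rightarrow> real) \<Rightarrow> nat \<Rightarrow> real" where
  "extended_diff N x k = (if k = 0 then 0 else if k = N then 2 * pi else x k)"

lemma phase_diff_eq_extended_diff:
  assumes "1 \<le> N" "\<forall>k\<in>{1..N - 1}. phase_diff N \<theta> k 0 = x k" "i \<le> N"
  shows "phase_diff N \<theta> i 0 = extended_diff N x i"
  using assms by (auto simp: extended_diff_def phase_diff_ends)

lemma extended_diff_mono:
  assumes "x \<in> closed_cone N" "2 \<le> N" "i \<in> {1..N}"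
  shows "extended_diff N x (i - 1) \<le> extended_diff N x i"
proof -
  have range: "0 \<le> x k \<and> x k \<le> 2 * pi" if "k \<in> {1..N - 1}" for k
    using assms(1) that by (simp add: closed_cone_def)
  consider "i = 1" | "i = N" | "1 < i" "i < N" using assms by force
  then show ?thesis
  proof cases
    case 3
    then have "1 \<le> i - 1 \<and> (i - 1) + 1 \<le> N - 1" by auto
    then have "x (i - 1) \<le> x ((i - 1) + 1)" using assms(1) unfolding closed_cone_def by blast
    moreover have "i - 1 \<noteq> N" using 3 by simp
    ultimately show ?thesis using 3 by (simp add: extended_diff_def)
  qed (use assms range in \<open>auto simp: extended_diff_def\<close>)
qed

text \<open>
  On a face, one of the coordinates equals a neighbouring one, \<open>0\<close> or \<open>2 * pi\<close>, so the face is the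
  graph of a nonexpansive function of the other \<open>N - 2\<close> coordinates.
\<close>

lemma AE_not_in_face:
  assumes N: "2 \<le> N" and i: "i \<in> {1..N}"
  shows "AE x in (\<Pi>\<^sub>M k\<in>{1..N - 1}. (lborel :: real measure)).
    x \<notin> {x \<in> closed_cone N. extended_diff N x (i - 1) = extended_diff N x i}" (is "AE x in _. x \<notin> ?S")
proof -
  (* p is the coordinate that the face condition determines. For i = N it must be N - 1, since
     index N carries the constant 2 * pi. *)
  define p where "p = (if i = N then i - 1 else i)"
  define q where "q = (if i = N then i else i - 1)"
  define J where "J = {1..N - 1} - {p}"
  have p: "p \<in> {1..N - 1}" and pq: "p \<noteq> q" "q \<le> N" using N i by (auto simp: p_def q_def)
  then have q: "q = 0 \<or> q = N \<or> q \<in> J" by (auto simp: J_def)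
  have graph: "x p = extended_diff N x q" if "x \<in> ?S" for x
    using that p by (auto simp: p_def q_def extended_diff_def split: if_splits)
  have "covered (sup_dist {1..N - 1}) (card J) ?S"
  proof (rule covered_bounded_graph[where B = 8])
    show "finite J" by (simp add: J_def)
    show "0 \<le> x k \<and> x k \<le> real 8" if "x \<in> ?S" "k \<in> J" for x k
    proof -
      have "0 \<le> x k \<and> x k \<le> 2 * pi" using that by (simp add: J_def closed_cone_def)
      with pi_less_4 show ?thesis by simp
    qed
    fix x y :: "nat \<Rightarrow> real" and e :: real
    assume x: "x \<in> ?S" and y: "y \<in> ?S" and e: "0 \<le> e" and close: "\<forall>k\<in>J. \<bar>x k - y k\<bar> \<le> e"
    have "\<bar>x p - y p\<bar> \<le> e"
      unfolding graph[OF x] graph[OF y] using q e close by (auto simp: extended_diff_def)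
    with close have "\<bar>x k - y k\<bar> \<le> e" if "k \<in> {1..N - 1}" for k using that by (cases "k = p") (auto simp: J_def)
    then show "sup_dist {1..N - 1} x y \<le> e" unfolding sup_dist_def using p by (subst Max_le_iff) auto
  qed
  then show ?thesis by (rule AE_not_in_covered[rotated]) (use p in \<open>auto simp: J_def\<close>)
qed

text \<open>
  Phase differences determine a state up to rotation, and they depend on it in a nonexpansive way.
\<close>

lemma AE_not_stuck:
  assumes N: "2 \<le> N" and \<Gamma>: "increasing_coupling \<Gamma>" "\<And>x. x \<in> {- (2 * pi)..2 * pi} \<Longrightarrow> \<bar>\<Gamma> x\<bar> \<le> B"
    and T: "0 \<le> T"
  shows "AE x in (\<Pi>\<^sub>M k\<in>{1..N - 1}. (lborel :: real measure)).
    x \<notin> {x. \<exists>s\<in>stuck N \<omega> \<Gamma> T {}. \<forall>k\<in>{1..N - 1}. x k = s (Suc k) - s 1}"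
proof (rule AE_not_in_covered)
  have "covered (phase_dist N) (N - 2) (stuck N \<omega> \<Gamma> T {})"
    using stuck_covered[OF _ \<Gamma> T, where Z = "{}" and N = N and \<omega> = \<omega>] N by simp
  then show "covered (sup_dist {1..N - 1}) (N - 2) {x. \<exists>s\<in>stuck N \<omega> \<Gamma> T {}. \<forall>k\<in>{1..N - 1}. x k = s (Suc k) - s 1}"
  proof (rule covered_transfer[where P = "\<lambda>x s. \<forall>k\<in>{1..N - 1}. x k = s (Suc k) - s 1"])
    fix x s y s' :: "nat \<Rightarrow> real"
    assume xs: "\<forall>k\<in>{1..N - 1}. x k = s (Suc k) - s 1" and ys: "\<forall>k\<in>{1..N - 1}. y k = s' (Suc k) - s' 1"
    have "\<bar>x k - y k\<bar> \<le> phase_dist N s s'" if k: "k \<in> {1..N - 1}" for k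
    proof -
      have "Suc k \<in> {1..N}" "1 \<in> {1..N}" using k by auto
      with spread_ge[of "{1..N}" "Suc k" 1 "\<lambda>k. s k - s' k"] spread_ge[of "{1..N}" 1 "Suc k" "\<lambda>k. s k - s' k"]
      show ?thesis using xs ys k by (simp add: phase_dist_def abs_le_iff)
    qed
    then show "sup_dist {1..N - 1} x y \<le> phase_dist N s s'"
      unfolding sup_dist_def using N by (subst Max_le_iff) auto
  qed blast
qed (use N in auto)

lemma collapsed_eventually_constant:
  assumes sol: "network_solution N \<omega> \<Gamma> \<theta>"
  obtains n :: nat where "\<And>t. real n \<le> t \<Longrightarrow> collapsed N \<theta> t = collapsed N \<theta> (real n)"
proof -
  have fin: "finite (collapsed N \<theta> t)" for t unfolding collapsed_def by simp
  have "\<exists>n::nat. \<forall>m. card (collapsed N \<theta> (real m)) \<le> card (collapsed N \<theta> (real n))"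
  proof (rule ex_has_greatest_nat[where P = "\<lambda>_. True" and b = "Suc N", simplified])
    show "\<forall>m. card (collapsed N \<theta> (real m)) < Suc N"
      using card_mono[of "{1..N}" "collapsed N \<theta> (real _)"] by (force simp: collapsed_def less_Suc_eq_le)
  qed
  then obtain n :: nat where n: "\<And>m. card (collapsed N \<theta> (real m)) \<le> card (collapsed N \<theta> (real n))" by blast
  have "collapsed N \<theta> t = collapsed N \<theta> (real n)" if t: "real n \<le> t" for t
  proof -
    have ceil: "t \<le> real (nat \<lceil>t\<rceil>)" by linarith
    have sub: "collapsed N \<theta> (real n) \<subseteq> collapsed N \<theta> t" "collapsed N \<theta> t \<subseteq> collapsed N \<theta> (real (nat \<lceil>t\<rceil>))"
      using t ceil by (intro collapsed_mono[OF sol]; simp)+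
    then have "card (collapsed N \<theta> t) \<le> card (collapsed N \<theta> (real n))"
      using n[of "nat \<lceil>t\<rceil>"] card_mono[OF fin sub(2)] by linarith
    then show ?thesis using card_seteq[OF fin sub(1)] by simp
  qed
  then show ?thesis by (rule that)
qed

text \<open>
  If at most one gap is open, it lies on one side of \<open>k\<close>, and the phase of oscillator \<open>k + 1\<close> is glued to
  \<open>0\<close> or to \<open>2 * pi\<close> by the collapsed gaps on the other side.
\<close>

lemma synchronized_of_card:
  assumes N: "1 \<le> N" and cone: "cone_at N \<theta> t" and card: "N < card (collapsed N \<theta> t) + 2" and k: "k \<le> N"
  shows "phase_diff N \<theta> k t \<in> {0, 2 * pi}"
proof (cases "{0<..k} \<subseteq> collapsed N \<theta> t")
  case True
  with phase_diff_eq_iff[OF cone, of 0 k] k have "phase_diff N \<theta> k t = 0" by (simp add: phase_diff_ends[OF N])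
  then show ?thesis by simp
next
  case False
  then obtain i where i: "i \<in> {0<..k}" "i \<notin> collapsed N \<theta> t" by blast
  have "{k<..N} \<subseteq> collapsed N \<theta> t"
  proof (rule subsetI, rule ccontr)
    fix j assume j: "j \<in> {k<..N}" "j \<notin> collapsed N \<theta> t"
    have "collapsed N \<theta> t \<subseteq> {1..N} - {i, j}" using i j unfolding collapsed_def by auto
    then have "card (collapsed N \<theta> t) \<le> card ({1..N} - {i, j})" by (intro card_mono) auto
    also have "\<dots> = N - 2" using i j k by (subst card_Diff_subset) auto
    finally show False using card i j k by auto
  qed
  with phase_diff_eq_iff[OF cone, of k N] k have "phase_diff N \<theta> k t = 2 * pi" by (simp add: phase_diff_ends[OF N])
  then show ?thesis by simp
qed

theorem theorem4p1:
  fixes N :: nat and \<omega> :: real and \<Gamma> :: "real \<Rightarrow> real"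
  assumes "N \<ge> 2"
    and "coupling_function \<Gamma>"
    and monotone:
      "(\<forall>x\<in>{0<..<2 * pi}. deriv \<Gamma> x > 0) \<or> (\<forall>x\<in>{0<..<2 * pi}. deriv \<Gamma> x < 0)"
    and curvature:
      "(\<forall>x\<in>{0<..<2 * pi}. deriv (deriv \<Gamma>) x \<ge> 0) \<or> (\<forall>x\<in>{0<..<2 * pi}. deriv (deriv \<Gamma>) x \<le> 0)"
  shows "AE x in (\<Pi>\<^sub>M k\<in>{1..N - 1}. (lborel :: real measure)).
    x \<in> closed_cone N \<longrightarrow>
    (\<forall>\<theta>. network_solution N \<omega> \<Gamma> \<theta> \<and> (\<forall>k\<in>{1..N - 1}. phase_diff N \<theta> k 0 = x k) \<longrightarrow>
      ((\<forall>y\<in>{0<..<2 * pi}. deriv \<Gamma> y < 0) \<longrightarrow>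
        (\<forall>k\<in>{1..N - 1}. (phase_diff N \<theta> k \<longlongrightarrow> real k * (2 * pi / real N)) at_top)) \<and>
      ((\<forall>y\<in>{0<..<2 * pi}. deriv \<Gamma> y > 0) \<longrightarrow>
        (\<exists>T\<ge>0. \<forall>t\<ge>T. \<forall>k\<in>{1..N - 1}. phase_diff N \<theta> k t \<in> {0, 2 * pi})))"
proof -
  let ?M = "\<Pi>\<^sub>M k\<in>{1..N - 1}. (lborel :: real measure)"
  let ?S = "\<lambda>n. {x. \<exists>s\<in>stuck N \<omega> \<Gamma> (real n) {}. \<forall>k\<in>{1..N - 1}. x k = s (Suc k) - s 1}"
  have N: "1 \<le> N" using \<open>N \<ge> 2\<close> by simp
  have "AE x in ?M. \<forall>i\<in>{1..N}. x \<notin> {x \<in> closed_cone N. extended_diff N x (i - 1) = extended_diff N x i}"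
    using AE_not_in_face[OF \<open>N \<ge> 2\<close>] by (intro AE_finite_allI) auto
  moreover have "AE x in ?M. (\<forall>y\<in>{0<..<2 * pi}. deriv \<Gamma> y > 0) \<longrightarrow> (\<forall>n. x \<notin> ?S n)"
  proof (cases "\<forall>y\<in>{0<..<2 * pi}. deriv \<Gamma> y > 0")
    case True
    then have inc: "increasing_coupling \<Gamma>" using increasing_coupling_of_deriv[OF assms(2), of 1] by simp
    obtain B where B: "\<And>x. x \<in> {- (2 * pi)..2 * pi} \<Longrightarrow> \<bar>\<Gamma> x\<bar> \<le> B"
      using increasing_coupling_bounded[OF assms(2) inc] by blast
    have "AE x in ?M. x \<notin> ?S n" for n using AE_not_stuck[OF \<open>N \<ge> 2\<close> inc B, of "real n" \<omega>] by simp
    then have "AE x in ?M. \<forall>n. x \<notin> ?S n" by (simp only: AE_all_countable) blast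
    then show ?thesis by eventually_elim blast
  next
    case False
    then show ?thesis by (intro AE_I2) blast
  qed
  ultimately show ?thesis
  proof eventually_elim
    case (elim x)
    show ?case
    proof (intro impI allI)
      fix \<theta> assume x: "x \<in> closed_cone N"
        and "network_solution N \<omega> \<Gamma> \<theta> \<and> (\<forall>k\<in>{1..N - 1}. phase_diff N \<theta> k 0 = x k)"
      then have sol: "network_solution N \<omega> \<Gamma> \<theta>" and init: "\<forall>k\<in>{1..N - 1}. phase_diff N \<theta> k 0 = x k" by blast+
      note ext = phase_diff_eq_extended_diff[OF N init]
      have ext': "phase_diff N \<theta> i 0 = extended_diff N x i \<and> phase_diff N \<theta> (i - 1) 0 = extended_diff N x (i - 1)"
        if "i \<in> {1..N}" for i using ext[of i] ext[of "i - 1"] that by auto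
      have cone: "cone_at N \<theta> 0"
        unfolding cone_at_def using extended_diff_mono[OF x \<open>N \<ge> 2\<close>] ext' by simp
      have open_cone: "collapsed N \<theta> 0 = {}"
        using elim(1) x ext' unfolding collapsed_def by auto
      show "((\<forall>y\<in>{0<..<2 * pi}. deriv \<Gamma> y < 0) \<longrightarrow>
          (\<forall>k\<in>{1..N - 1}. (phase_diff N \<theta> k \<longlongrightarrow> real k * (2 * pi / real N)) at_top)) \<and>
        ((\<forall>y\<in>{0<..<2 * pi}. deriv \<Gamma> y > 0) \<longrightarrow>
          (\<exists>T\<ge>0. \<forall>t\<ge>T. \<forall>k\<in>{1..N - 1}. phase_diff N \<theta> k t \<in> {0, 2 * pi}))"
      proof (intro conjI impI)
        assume "\<forall>y\<in>{0<..<2 * pi}. deriv \<Gamma> y < 0"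
        then have "increasing_coupling (\<lambda>x. - \<Gamma> x)"
          using increasing_coupling_of_deriv[OF assms(2), of "-1"] by simp
        from decreasing_converges_to_splay[OF N this sol cone open_cone]
        show "\<forall>k\<in>{1..N - 1}. (phase_diff N \<theta> k \<longlongrightarrow> real k * (2 * pi / real N)) at_top" by auto
      next
        assume pos: "\<forall>y\<in>{0<..<2 * pi}. deriv \<Gamma> y > 0"
        obtain n where n: "\<And>t. real n \<le> t \<Longrightarrow> collapsed N \<theta> t = collapsed N \<theta> (real n)"
          using collapsed_eventually_constant[OF sol] by blast
        have card: "N < card (collapsed N \<theta> (real n)) + 2"
        proof (rule ccontr)
          assume "\<not> N < card (collapsed N \<theta> (real n)) + 2"
          then have "(\<lambda>k. \<theta> k 0) \<in> stuck N \<omega> \<Gamma> (real n) {}"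
            unfolding stuck_def using sol cone open_cone
            by (intro CollectI exI[of _ \<theta>] conjI allI impI n) simp_all
          moreover have "\<forall>k\<in>{1..N - 1}. x k = \<theta> (Suc k) 0 - \<theta> 1 0"
          proof
            fix k assume k: "k \<in> {1..N - 1}"
            then have "k \<noteq> N" by auto
            with bspec[OF init k] show "x k = \<theta> (Suc k) 0 - \<theta> 1 0" by (simp add: phase_diff_def)
          qed
          ultimately have "x \<in> ?S n" by (intro CollectI bexI[of _ "\<lambda>k. \<theta> k 0"])
          with mp[OF elim(2) pos] show False by blast
        qed
        show "\<exists>T\<ge>0. \<forall>t\<ge>T. \<forall>k\<in>{1..N - 1}. phase_diff N \<theta> k t \<in> {0, 2 * pi}"
        proof (intro exI[of _ "real n"] conjI allI impI ballI)
          fix t k assume t: "real n \<le> t" and k: "k \<in> {1..N - 1}"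
          show "phase_diff N \<theta> k t \<in> {0, 2 * pi}"
          proof (rule synchronized_of_card[OF N])
            show "cone_at N \<theta> t" using t by (intro cone_at_forever[OF sol cone]) simp
            show "N < card (collapsed N \<theta> t) + 2" unfolding n[OF t] by (rule card)
            show "k \<le> N" using k by auto
          qed
        qed simp
      qed
    qed
  qed
qed

end
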